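(* If $M$ is a term of $\ell\Lambda_\infty^{4S}$, $M\Rightarrow N$ and $M\Rightarrow L$, then there is a term $P$ of $\ell\Lambda_\infty^{4S}$ such that $N\Rightarrow P$ and $L\Rightarrow P$.
   Context: Preterms: possibly infinite trees generated by $M ::= x \mid MN \mid \lambda x.M \mid \lambda^{\downarrow}x.M \mid \lambda^{\uparrow}x.M \mid \downarrow M \mid \uparrow M$ ($\downarrow M$ inductive box, $\uparrow M$ coinductive box); substitution is capture-avoiding. Patterns: $x,\downarrow x,\uparrow x,\#x,\dagger x$; environments: finite sets of patterns, each variable in at most one; $\Theta,\Xi,\Psi,\Phi$ linear environments with marked versions $\#\Theta$ etc.; $\Upsilon,\Pi$ environments with only patterns $y$, $\downarrow y$; commas are disjoint unions. A term of $\ell\Lambda_\infty^{4S}$ is a preterm $M$ with $\Gamma\vdash M$ derivable for some $\Gamma$ by: (vl) $\#\Theta,\uparrow\Xi,\dagger\Psi,x\vdash x$; (vd) $\#\Theta,\uparrow\Xi,\dagger\Psi,\#x\vdash x$; (va) $\#\Theta,\uparrow\Xi,\dagger\Psi,\dagger x\vdash x$; (a) from $\Upsilon,\#\Theta,\uparrow\Xi,\dagger\Psi\vdash M$ and $\Pi,\#\Theta,\uparrow\Xi,\dagger\Psi\vdash N$ infer $\Upsilon,\Pi,\#\Theta,\uparrow\Xi,\dagger\Psi\vdash MN$; (ll) $\Gamma,x\vdash M$ gives $\Gamma\vdash\lambda x.M$; (li)$_1$ $\Gamma,\#x\vdash M$ gives $\Gamma\vdash\lambda^\downarrow x.M$;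 (li)$_2$ $\Gamma,\downarrow x\vdash M$ gives $\Gamma\vdash\lambda^\downarrow x.M$; (lc) $\Gamma,\uparrow x\vdash M$ gives $\Gamma\vdash\lambda^\uparrow x.M$; (mi) from $\Xi,\uparrow\Psi,\dagger\Phi\vdash M$ infer $\#\Theta,\downarrow\Xi,\uparrow\Psi,\dagger\Phi\vdash\downarrow M$; (mc) from $\dagger\Xi,\dagger\Psi\vdash M$ infer $\#\Theta,\uparrow\Xi,\dagger\Psi\vdash\uparrow M$; (mc) coinductive, others inductive (every infinite branch of a derivation contains infinitely many (mc)). Basic reduction: $(\lambda x.M)N\mapsto M[N/x]$, $(\lambda^\downarrow x.M)(\downarrow N)\mapsto M[N/x]$, $(\lambda^\uparrow x.M)(\uparrow N)\mapsto M[N/x]$; $M\to N$ iff $M=C[L]$, $N=C[P]$, $L\mapsto P$ for a one-hole context $C$. Infinitary reduction $\Rightarrow$ and auxiliary $\leadsto$ are given by the mixed formal system: (coinductive rule) if $M\to^*N$ and $N\leadsto L$ then $M\Rightarrow L$; (inductive rules) $x\leadsto x$; if $M\leadsto N$ and $L\leadsto P$ then $ML\leadsto NP$; if $M\leadsto N$ then $\lambda x.M\leadsto\lambda x.N$, $\lambda^\downarrow x.M\leadsto\lambda^\downarrow x.N$, $\lambda^\uparrow x.M\leadsto\lambda^\uparrow x.N$ and $\downarrow M\leadsto\downarrow N$; if $M\Rightarrow N$ then $\uparrow M\leadsto\uparrow N$. A judgment holds iff it is the root of a possibly infinite derivation tree in which every infinite branch uses the coinductive rule infinitely often. *)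

theory Defs
  imports Main
begin

text \<open>Var i: variable (de Bruijn index); App; Lam (plain lambda); LamI (lambda-down);
  LamC (lambda-up); IBox (inductive box, down M); CBox (coinductive box, up M).\<close>

codatatype trm =
    Var nat
  | App trm trm
  | Lam trm
  | LamI trm
  | LamC trm
  | IBox trm
  | CBox trm

definition upr :: "(nat \<Rightarrow> nat) \<Rightarrow> nat \<Rightarrow> nat" where
  "upr f i = (case i of 0 \<Rightarrow> 0 | Suc j \<Rightarrow> Suc (f j))"

primcorec ren :: "(nat \<Rightarrow> nat) \<Rightarrow> trm \<Rightarrow> trm" where
  "ren f t = (case t of
      Var i \<Rightarrow> Var (f i)
    | App a b \<Rightarrow> App (ren f a) (ren f b)
    | Lam a \<Rightarrow> Lam (ren (upr f) a)
    | LamI a \<Rightarrow> LamI (ren (upr f) a)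
    | LamC a \<Rightarrow> LamC (ren (upr f) a)
    | IBox a \<Rightarrow> IBox (ren f a)
    | CBox a \<Rightarrow> CBox (ren f a))"

definition ups :: "(nat \<Rightarrow> trm) \<Rightarrow> nat \<Rightarrow> trm" where
  "ups \<sigma> i = (case i of 0 \<Rightarrow> Var 0 | Suc j \<Rightarrow> ren Suc (\<sigma> j))"

primcorec subst :: "(nat \<Rightarrow> trm) \<Rightarrow> trm \<Rightarrow> trm" where
  "subst \<sigma> t = (case t of
      Var i \<Rightarrow> \<sigma> i
    | App a b \<Rightarrow> App (subst \<sigma> a) (subst \<sigma> b)
    | Lam a \<Rightarrow> Lam (subst (ups \<sigma>) a)
    | LamI a \<Rightarrow> LamI (subst (ups \<sigma>) a)
    | LamC a \<Rightarrow> LamC (subst (ups \<sigma>) a)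
    | IBox a \<Rightarrow> IBox (subst \<sigma> a)
    | CBox a \<Rightarrow> CBox (subst \<sigma> a))"

definition sub1 :: "trm \<Rightarrow> nat \<Rightarrow> trm" where
  "sub1 N i = (case i of 0 \<Rightarrow> N | Suc j \<Rightarrow> Var j)"

definition inst :: "trm \<Rightarrow> trm \<Rightarrow> trm" where
  "inst M N = subst (sub1 N) M"

text \<open>Pattern kinds: PL = x, PI = down x, PC = up x, PH = #x, PD = dagger x.\<close>
datatype pk = PL | PI | PC | PH | PD

type_synonym env = "nat \<Rightarrow> pk option"

definition econs :: "pk \<Rightarrow> env \<Rightarrow> env" where
  "econs k \<Gamma> i = (case i of 0 \<Rightarrow> Some k | Suc j \<Rightarrow> \<Gamma> j)"

definition esplit :: "env \<Rightarrow> env \<Rightarrow> env \<Rightarrow> bool" where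
  "esplit \<Gamma> \<Gamma>1 \<Gamma>2 \<longleftrightarrow> (\<forall>i. case \<Gamma> i of
       None \<Rightarrow> \<Gamma>1 i = None \<and> \<Gamma>2 i = None
     | Some k \<Rightarrow> (if k = PL \<or> k = PI
                  then (\<Gamma>1 i = Some k \<and> \<Gamma>2 i = None) \<or> (\<Gamma>1 i = None \<and> \<Gamma>2 i = Some k)
                  else \<Gamma>1 i = Some k \<and> \<Gamma>2 i = Some k))"

definition mi_env :: "env \<Rightarrow> env" where
  "mi_env \<Gamma> i = (case \<Gamma> i of
      Some PH \<Rightarrow> None | Some PI \<Rightarrow> Some PL | Some PC \<Rightarrow> Some PC | Some PD \<Rightarrow> Some PD
    | Some PL \<Rightarrow> None | None \<Rightarrow> None)"

definition mc_env :: "env \<Rightarrow> env" where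
  "mc_env \<Gamma> i = (case \<Gamma> i of
      Some PH \<Rightarrow> None | Some PC \<Rightarrow> Some PD | Some PD \<Rightarrow> Some PD
    | Some PL \<Rightarrow> None | Some PI \<Rightarrow> None | None \<Rightarrow> None)"

text \<open>Inductive rules; the coinductive rule (mc) refers to the parameter X.\<close>
inductive typ_step :: "(env \<Rightarrow> trm \<Rightarrow> bool) \<Rightarrow> env \<Rightarrow> trm \<Rightarrow> bool" for X where
  tvar: "\<Gamma> i \<in> {Some PL, Some PH, Some PD} \<Longrightarrow>
         (\<forall>j. j \<noteq> i \<longrightarrow> \<Gamma> j \<in> {None, Some PH, Some PC, Some PD}) \<Longrightarrow>
         typ_step X \<Gamma> (Var i)"
| tapp: "esplit \<Gamma> \<Gamma>1 \<Gamma>2 \<Longrightarrow> typ_step X \<Gamma>1 M \<Longrightarrow> typ_step X \<Gamma>2 N \<Longrightarrow>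
         typ_step X \<Gamma> (App M N)"
| tll: "typ_step X (econs PL \<Gamma>) M \<Longrightarrow> typ_step X \<Gamma> (Lam M)"
| tli1: "typ_step X (econs PH \<Gamma>) M \<Longrightarrow> typ_step X \<Gamma> (LamI M)"
| tli2: "typ_step X (econs PI \<Gamma>) M \<Longrightarrow> typ_step X \<Gamma> (LamI M)"
| tlc: "typ_step X (econs PC \<Gamma>) M \<Longrightarrow> typ_step X \<Gamma> (LamC M)"
| tmi: "(\<forall>i. \<Gamma> i \<noteq> Some PL) \<Longrightarrow> typ_step X (mi_env \<Gamma>) M \<Longrightarrow> typ_step X \<Gamma> (IBox M)"
| tmc: "(\<forall>i. \<Gamma> i \<noteq> Some PL \<and> \<Gamma> i \<noteq> Some PI) \<Longrightarrow> X (mc_env \<Gamma>) M \<Longrightarrow>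
        typ_step X \<Gamma> (CBox M)"

lemma typ_step_mono[mono]:
  "(\<And>\<Gamma> M. X \<Gamma> M \<longrightarrow> Y \<Gamma> M) \<Longrightarrow> typ_step X \<Gamma> M \<longrightarrow> typ_step Y \<Gamma> M"
proof
  assume XY: "\<And>\<Gamma> M. X \<Gamma> M \<longrightarrow> Y \<Gamma> M" and H: "typ_step X \<Gamma> M"
  from H show "typ_step Y \<Gamma> M"
    by (induction rule: typ_step.induct) (auto intro: typ_step.intros simp: XY)
qed

coinductive typed :: "env \<Rightarrow> trm \<Rightarrow> bool" where
  "typ_step typed \<Gamma> M \<Longrightarrow> typed \<Gamma> M"

definition lterm :: "trm \<Rightarrow> bool" where
  "lterm M \<longleftrightarrow> (\<exists>\<Gamma>. finite (dom \<Gamma>) \<and> typed \<Gamma> M)"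

inductive beta :: "trm \<Rightarrow> trm \<Rightarrow> bool" where
  "beta (App (Lam M) N) (inst M N)"
| "beta (App (LamI M) (IBox N)) (inst M N)"
| "beta (App (LamC M) (CBox N)) (inst M N)"

inductive step :: "trm \<Rightarrow> trm \<Rightarrow> bool" where
  "beta M N \<Longrightarrow> step M N"
| "step M M' \<Longrightarrow> step (App M N) (App M' N)"
| "step N N' \<Longrightarrow> step (App M N) (App M N')"
| "step M M' \<Longrightarrow> step (Lam M) (Lam M')"
| "step M M' \<Longrightarrow> step (LamI M) (LamI M')"
| "step M M' \<Longrightarrow> step (LamC M) (LamC M')"
| "step M M' \<Longrightarrow> step (IBox M) (IBox M')"
| "step M M' \<Longrightarrow> step (CBox M) (CBox M')"

text \<open>Auxiliary relation (inductive), with parameter X standing for the infinitary reduction.\<close>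
inductive lstep :: "(trm \<Rightarrow> trm \<Rightarrow> bool) \<Rightarrow> trm \<Rightarrow> trm \<Rightarrow> bool" for X where
  "lstep X (Var x) (Var x)"
| "lstep X M N \<Longrightarrow> lstep X L P \<Longrightarrow> lstep X (App M L) (App N P)"
| "lstep X M N \<Longrightarrow> lstep X (Lam M) (Lam N)"
| "lstep X M N \<Longrightarrow> lstep X (LamI M) (LamI N)"
| "lstep X M N \<Longrightarrow> lstep X (LamC M) (LamC N)"
| "lstep X M N \<Longrightarrow> lstep X (IBox M) (IBox N)"
| "X M N \<Longrightarrow> lstep X (CBox M) (CBox N)"

lemma lstep_mono[mono]:
  "(\<And>M N. X M N \<longrightarrow> Y M N) \<Longrightarrow> lstep X M N \<longrightarrow> lstep Y M N"
proof
  assume XY: "\<And>M N. X M N \<longrightarrow> Y M N" and H: "lstep X M N"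
  from H show "lstep Y M N"
    by (induction rule: lstep.induct) (auto intro: lstep.intros simp: XY)
qed

coinductive infred :: "trm \<Rightarrow> trm \<Rightarrow> bool" where
  "step\<^sup>*\<^sup>* M N \<Longrightarrow> lstep infred N L \<Longrightarrow> infred M L"

end

theory Submission
  imports Defs "HOL-Library.Confluence"
begin

text \<open>Call a position of a term a surface position if it lies in no coinductive box. Typing
  implies that the surface of a term is finite, that a variable bound by \<^const>\<open>Lam\<close> or
  \<^const>\<open>LamI\<close> occurs only at the surface of the body, and that a variable bound by
  \<^const>\<open>LamC\<close> occurs only inside coinductive boxes. Hence surface reduction is confluent by
  parallel reductions, and reductions inside coinductive boxes commute with surface steps in both
  directions. Therefore the finite reductions in the definition of \<^const>\<open>infred\<close> may be
  restricted to surface steps. Two infinitary reducts of a term then have surface reducts of the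
  same surface shape whose coinductive boxes contain, pairwise, two infinitary reducts of a common
  term, so the common reduct is built corecursively. It is typable by subject reduction.\<close>

section \<open>Substitution algebra\<close>

text \<open>Two obstacles shape the statements. A preterm may have an infinite surface, so the
  inductive relations \<open>par\<close> and \<open>lstep\<close> are not reflexive in general;
  lemmas therefore assume that their source is typable or, for intermediate terms not yet known to
  be typable, that \<open>lstep infred0 M M\<close> holds. Moreover, subject reduction does not keep
  the environment: contracting a redex whose bound variable is marked may copy a term with a linear
  variable, which must then become marked as well. A corecursive typing derivation could not
  tolerate this at every layer. But \<open>mc_env\<close> produces no inductive pattern, so inside
  coinductive boxes the environment is kept exactly and only the outermost layer changes it. Typing
  and reduction are mixed fixpoints. Properties are proved by rule induction over one layer, with a
  predicate parameter for the contents of coinductive boxes, and then by coinduction over the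
  layers.\<close>

lemma ren_simps [simp]:
  "ren f (Var i) = Var (f i)"
  "ren f (App a b) = App (ren f a) (ren f b)"
  "ren f (Lam a) = Lam (ren (upr f) a)"
  "ren f (LamI a) = LamI (ren (upr f) a)"
  "ren f (LamC a) = LamC (ren (upr f) a)"
  "ren f (IBox a) = IBox (ren f a)"
  "ren f (CBox a) = CBox (ren f a)"
  by (subst ren.code, simp)+

lemma subst_simps [simp]:
  "subst \<sigma> (Var i) = \<sigma> i"
  "subst \<sigma> (App a b) = App (subst \<sigma> a) (subst \<sigma> b)"
  "subst \<sigma> (Lam a) = Lam (subst (ups \<sigma>) a)"
  "subst \<sigma> (LamI a) = LamI (subst (ups \<sigma>) a)"
  "subst \<sigma> (LamC a) = LamC (subst (ups \<sigma>) a)"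
  "subst \<sigma> (IBox a) = IBox (subst \<sigma> a)"
  "subst \<sigma> (CBox a) = CBox (subst \<sigma> a)"
  by (subst subst.code, simp)+

lemma upr_simps [simp]: "upr f 0 = 0" "upr f (Suc i) = Suc (f i)"
  by (simp_all add: upr_def)

lemma ups_simps [simp]: "ups \<sigma> 0 = Var 0" "ups \<sigma> (Suc i) = ren Suc (\<sigma> i)"
  by (simp_all add: ups_def)

lemma sub1_simps [simp]: "sub1 N 0 = N" "sub1 N (Suc i) = Var i"
  by (simp_all add: sub1_def)

lemma fun_eq_0_SucI: "f 0 = g 0 \<Longrightarrow> (\<And>i. f (Suc i) = g (Suc i)) \<Longrightarrow> f = g"
  by (rule ext) (metis not0_implies_Suc)

lemma upr_comp: "upr (\<lambda>i. f (g i)) = (\<lambda>i. upr f (upr g i))"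
  by (rule fun_eq_0_SucI) simp_all

lemma upr_id: "upr (\<lambda>i. i) = (\<lambda>i. i)"
  by (rule fun_eq_0_SucI) simp_all

lemma ren_id: "ren (\<lambda>i. i) M = M"
proof (coinduction arbitrary: M rule: trm.coinduct_strong)
  case Eq_trm
  show ?case by (cases M) (simp_all add: upr_id)
qed

text \<open>The fusion laws are ordered by what lifting requires. Since \<open>ups\<close> contains
  \<open>ren Suc\<close>, passing a binder in \<open>ren_subst\<close> uses \<open>ren_ren\<close>,
  and in \<open>subst_subst\<close> it uses both \<open>subst_ren\<close> and
  \<open>ren_subst\<close>.\<close>

lemma ren_ren: "ren f (ren g M) = ren (\<lambda>i. f (g i)) M"
proof (coinduction arbitrary: f g M rule: trm.coinduct_strong)
  case Eq_trm
  show ?case by (cases M) (simp_all add: upr_comp, blast+)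
qed

lemma subst_ren: "subst \<sigma> (ren f M) = subst (\<lambda>i. \<sigma> (f i)) M"
proof (coinduction arbitrary: f \<sigma> M rule: trm.coinduct_strong)
  case Eq_trm
  have "ups (\<lambda>i. \<sigma> (f i)) = (\<lambda>i. ups \<sigma> (upr f i))"
    by (rule fun_eq_0_SucI) simp_all
  then show ?case by (cases M) (simp_all, blast+)
qed

lemma ups_ren: "ups (\<lambda>i. ren f (\<sigma> i)) = (\<lambda>i. ren (upr f) (ups \<sigma> i))"
  by (rule fun_eq_0_SucI) (simp_all add: ren_ren)

lemma ren_subst: "ren f (subst \<sigma> M) = subst (\<lambda>i. ren f (\<sigma> i)) M"
proof (coinduction arbitrary: f \<sigma> M rule: trm.coinduct_strong)
  case Eq_trm
  show ?case by (cases M) (simp_all add: ups_ren, blast+)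
qed

lemma ups_subst: "ups (\<lambda>i. subst \<tau> (\<sigma> i)) = (\<lambda>i. subst (ups \<tau>) (ups \<sigma> i))"
  by (rule fun_eq_0_SucI) (simp_all add: subst_ren ren_subst)

lemma subst_subst: "subst \<tau> (subst \<sigma> M) = subst (\<lambda>i. subst \<tau> (\<sigma> i)) M"
proof (coinduction arbitrary: \<tau> \<sigma> M rule: trm.coinduct_strong)
  case Eq_trm
  show ?case by (cases M) (simp_all add: ups_subst, blast+)
qed

lemma ups_Var: "ups Var = Var"
  by (rule fun_eq_0_SucI) simp_all

lemma subst_Var: "subst Var M = M"
proof (coinduction arbitrary: M rule: trm.coinduct_strong)
  case Eq_trm
  show ?case by (cases M) (simp_all add: ups_Var)
qed

lemma ren_inst: "ren f (inst M N) = inst (ren (upr f) M) (ren f N)"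
proof -
  have "(\<lambda>i. ren f (sub1 N i)) = (\<lambda>i. sub1 (ren f N) (upr f i))"
    by (rule fun_eq_0_SucI) simp_all
  then show ?thesis by (simp add: inst_def ren_subst subst_ren)
qed

lemma subst_inst: "subst \<sigma> (inst M N) = inst (subst (ups \<sigma>) M) (subst \<sigma> N)"
proof -
  have "(\<lambda>i. subst \<sigma> (sub1 N i)) = (\<lambda>i. subst (sub1 (subst \<sigma> N)) (ups \<sigma> i))"
    by (rule fun_eq_0_SucI) (simp_all add: subst_ren subst_Var)
  then show ?thesis by (simp add: inst_def subst_subst)
qed

section \<open>Typing\<close>

lemma econs_simps [simp]: "econs k \<Gamma> 0 = Some k" "econs k \<Gamma> (Suc i) = \<Gamma> i"
  by (simp_all add: econs_def)

lemma typed_iff: "typed \<Gamma> M \<longleftrightarrow> typ_step typed \<Gamma> M"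
  by (auto intro: typed.intros elim: typed.cases)

inductive_cases typ_step_VarE: "typ_step X \<Gamma> (Var i)"
inductive_cases typ_step_AppE: "typ_step X \<Gamma> (App M N)"
inductive_cases typ_step_LamE: "typ_step X \<Gamma> (Lam M)"
inductive_cases typ_step_LamIE: "typ_step X \<Gamma> (LamI M)"
inductive_cases typ_step_LamCE: "typ_step X \<Gamma> (LamC M)"
inductive_cases typ_step_IBoxE: "typ_step X \<Gamma> (IBox M)"
inductive_cases typ_step_CBoxE: "typ_step X \<Gamma> (CBox M)"

lemmas typed_intros = typ_step.intros[where X = typed, folded typed_iff]
lemmas typed_VarE = typ_step_VarE[where X = typed, folded typed_iff]
lemmas typed_AppE = typ_step_AppE[where X = typed, folded typed_iff]
lemmas typed_LamE = typ_step_LamE[where X = typed, folded typed_iff]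
lemmas typed_LamIE = typ_step_LamIE[where X = typed, folded typed_iff]
lemmas typed_LamCE = typ_step_LamCE[where X = typed, folded typed_iff]
lemmas typed_IBoxE = typ_step_IBoxE[where X = typed, folded typed_iff]
lemmas typed_CBoxE = typ_step_CBoxE[where X = typed, folded typed_iff]

definition linear :: "pk option \<Rightarrow> bool" where
  "linear k \<longleftrightarrow> k = Some PL \<or> k = Some PI"

text \<open>Splitting at a single variable. It turns facts about environments into finite case
  analyses on optional kinds.\<close>

definition osplit :: "pk option \<Rightarrow> pk option \<Rightarrow> pk option \<Rightarrow> bool" where
  "osplit a b c \<longleftrightarrow> (if linear a then b = a \<and> c = None \<or> b = None \<and> c = a else b = a \<and> c = a)"

lemma esplit_iff: "esplit \<Gamma> \<Gamma>1 \<Gamma>2 \<longleftrightarrow> (\<forall>i. osplit (\<Gamma> i) (\<Gamma>1 i) (\<Gamma>2 i))"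
proof -
  have "(case a of None \<Rightarrow> b = None \<and> c = None
     | Some k \<Rightarrow> (if k = PL \<or> k = PI then b = Some k \<and> c = None \<or> b = None \<and> c = Some k
                  else b = Some k \<and> c = Some k)) = osplit a b c" for a b c
    by (auto simp: osplit_def linear_def split: option.split)
  then show ?thesis by (simp add: esplit_def)
qed

lemma osplitE:
  assumes "osplit a b c"
  obtains "linear a" "b = a" "c = None" | "linear a" "b = None" "c = a" | "\<not> linear a" "b = a" "c = a"
  using assms by (auto simp: osplit_def split: if_splits)

lemma osplit_commute: "osplit a b c \<Longrightarrow> osplit a c b"
  by (auto simp: osplit_def split: if_splits)

lemma osplit_assoc: "osplit a b c \<Longrightarrow> osplit b d e \<Longrightarrow> \<exists>x. osplit a x e \<and> osplit x d c"
  by (erule osplitE; erule osplitE) (auto simp: osplit_def linear_def)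

text \<open>A linear entry may stay linear or vanish, and a nonlinear one may not become linear;
  both box operations on environments act on each entry in this way.\<close>

lemma osplit_map:
  assumes "osplit a b c" and "h None = None" and "linear (h a) \<longleftrightarrow> linear a \<and> h a \<noteq> None"
  shows "osplit (h a) (h b) (h c)"
  using assms by (elim osplitE) (auto simp: osplit_def)

lemma esplit_commute: "esplit \<Gamma> \<Gamma>1 \<Gamma>2 \<Longrightarrow> esplit \<Gamma> \<Gamma>2 \<Gamma>1"
  by (auto simp: esplit_iff osplit_commute)

lemma esplit_assoc:
  assumes "esplit \<Gamma> \<Gamma>1 \<Gamma>2" and "esplit \<Gamma>1 \<Gamma>3 \<Gamma>4"
  obtains \<Delta> where "esplit \<Gamma> \<Delta> \<Gamma>4" and "esplit \<Delta> \<Gamma>3 \<Gamma>2"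
proof -
  have "\<exists>d. osplit (\<Gamma> i) d (\<Gamma>4 i) \<and> osplit d (\<Gamma>3 i) (\<Gamma>2 i)" for i
    using assms by (intro osplit_assoc[of _ "\<Gamma>1 i"]) (simp_all add: esplit_iff)
  then show ?thesis using that by (metis esplit_iff)
qed

text \<open>The right component belongs to the argument of a substitution carried under a binder.
  The argument does not use the new variable, so a linear one goes entirely to the left and any
  other is shared.\<close>

lemma esplit_econs: "esplit \<Gamma> \<Gamma>1 \<Gamma>2 \<Longrightarrow> esplit (econs k \<Gamma>) (econs k \<Gamma>1)
    (case_nat (if linear (Some k) then None else Some k) \<Gamma>2)"
  by (auto simp: esplit_iff osplit_def econs_def split: nat.split)

lemma esplit_nonlinear:
  assumes "esplit \<Gamma> \<Gamma>1 \<Gamma>2" and "\<forall>i. \<not> linear (\<Gamma>1 i)"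
  shows "\<Gamma>2 = \<Gamma>"
proof
  fix i
  have "osplit (\<Gamma> i) (\<Gamma>1 i) (\<Gamma>2 i)" "\<not> linear (\<Gamma>1 i)"
    using assms by (simp_all add: esplit_iff)
  then show "\<Gamma>2 i = \<Gamma> i" by (auto simp: osplit_def split: if_splits)
qed

lemma linear_simps [simp]:
  "linear (Some PL)" "linear (Some PI)" "\<not> linear None"
  "\<not> linear (Some PH)" "\<not> linear (Some PC)" "\<not> linear (Some PD)"
  by (simp_all add: linear_def)

lemma not_linear_cases: "\<not> linear k \<Longrightarrow> k \<in> {None, Some PH, Some PC, Some PD}"
  by (cases k) (auto simp: linear_def intro: pk.exhaust)

lemma linear_mi_env: "linear (mi_env \<Gamma> i) \<longleftrightarrow> \<Gamma> i = Some PI"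
  by (auto simp: mi_env_def split: option.split pk.split)

lemma not_linear_mc_env: "\<not> linear (mc_env \<Gamma> i)"
  by (auto simp: mc_env_def split: option.split pk.split)

lemma esplit_mi_env:
  assumes "esplit \<Gamma> \<Gamma>1 \<Gamma>2"
  shows "esplit (mi_env \<Gamma>) (mi_env \<Gamma>1) (mi_env \<Gamma>2)"
  unfolding esplit_iff
proof
  fix i
  have "osplit (\<Gamma> i) (\<Gamma>1 i) (\<Gamma>2 i)" using assms by (simp add: esplit_iff)
  \<comment> \<open>The constant environment presents \<open>mi_env\<close> as a map on optional
    kinds, as \<open>osplit_map\<close> expects.\<close>
  then have "osplit (mi_env (\<lambda>_. \<Gamma> i) i) (mi_env (\<lambda>_. \<Gamma>1 i) i) (mi_env (\<lambda>_. \<Gamma>2 i) i)"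
    by (rule osplit_map) (auto simp: linear_mi_env, auto simp: mi_env_def linear_def)
  then show "osplit (mi_env \<Gamma> i) (mi_env \<Gamma>1 i) (mi_env \<Gamma>2 i)"
    by (simp add: mi_env_def)
qed

lemma esplit_mc_env:
  assumes "esplit \<Gamma> \<Gamma>1 \<Gamma>2"
  shows "esplit (mc_env \<Gamma>) (mc_env \<Gamma>1) (mc_env \<Gamma>2)"
  unfolding esplit_iff
proof
  fix i
  have "osplit (\<Gamma> i) (\<Gamma>1 i) (\<Gamma>2 i)" using assms by (simp add: esplit_iff)
  then have "osplit (mc_env (\<lambda>_. \<Gamma> i) i) (mc_env (\<lambda>_. \<Gamma>1 i) i) (mc_env (\<lambda>_. \<Gamma>2 i) i)"
    by (rule osplit_map) (auto simp: not_linear_mc_env, auto simp: mc_env_def linear_def)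
  then show "osplit (mc_env \<Gamma> i) (mc_env \<Gamma>1 i) (mc_env \<Gamma>2 i)"
    by (simp add: mc_env_def)
qed

lemma mi_env_eq_Some_iff:
  "mi_env \<Gamma> i = Some k \<longleftrightarrow>
    \<Gamma> i = Some PI \<and> k = PL \<or> \<Gamma> i = Some PC \<and> k = PC \<or> \<Gamma> i = Some PD \<and> k = PD"
  by (auto simp: mi_env_def split: option.splits pk.splits)

lemma mc_env_eq_Some_iff:
  "mc_env \<Gamma> i = Some k \<longleftrightarrow> (\<Gamma> i = Some PC \<or> \<Gamma> i = Some PD) \<and> k = PD"
  by (auto simp: mc_env_def split: option.splits pk.splits)

text \<open>A coinductive box sees the same variables with or without an inductive box around it.
  Hence the argument of a coinductive variable stays typed in the same environment when a
  substitution enters an inductive box.\<close>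

lemma mc_env_mi_env [simp]: "mc_env (mi_env \<Gamma>) = mc_env \<Gamma>"
  by (rule ext) (auto simp: mc_env_def mi_env_def split: option.split pk.split)

section \<open>Renaming and weakening\<close>

text \<open>Replacing PL by PH is sound because the variable rule accepts both, boxes exclude PL,
  and PH survives every splitting. It is what lets a formerly linear variable be copied after its
  inductive box is opened.\<close>

definition weakens :: "pk option \<Rightarrow> pk option \<Rightarrow> bool" where
  "weakens a b \<longleftrightarrow> a = b \<or> a = None \<and> \<not> linear b \<or> a = Some PL \<and> b = Some PH"

definition renames :: "(nat \<Rightarrow> nat) \<Rightarrow> env \<Rightarrow> env \<Rightarrow> bool" where
  "renames f \<Gamma> \<Delta> \<longleftrightarrow>
    inj f \<and> (\<forall>i. weakens (\<Gamma> i) (\<Delta> (f i))) \<and> (\<forall>j. j \<notin> range f \<longrightarrow> \<not> linear (\<Delta> j))"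

lemma range_upr: "j \<notin> range (upr f) \<longleftrightarrow> (\<exists>i. j = Suc i \<and> i \<notin> range f)"
proof (cases j)
  case 0
  then show ?thesis using rangeI[of "upr f" 0] by auto
next
  case (Suc i)
  have "Suc i \<in> range (upr f) \<longleftrightarrow> i \<in> range f"
  proof
    assume "Suc i \<in> range (upr f)"
    then obtain n where "Suc i = upr f n" by blast
    then show "i \<in> range f" by (cases n) auto
  next
    assume "i \<in> range f"
    then show "Suc i \<in> range (upr f)" by (metis imageE rangeI upr_simps(2))
  qed
  then show ?thesis using Suc by simp
qed

lemma renames_econs:
  assumes "renames f \<Gamma> \<Delta>" shows "renames (upr f) (econs k \<Gamma>) (econs k \<Delta>)"
proof -
  have "inj f" and w: "weakens (\<Gamma> i) (\<Delta> (f i))" for i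
    using assms by (simp_all add: renames_def)
  have "inj (upr f)"
  proof (rule injI)
    fix i j
    assume "upr f i = upr f j"
    then show "i = j" by (cases i; cases j) (auto dest: injD[OF \<open>inj f\<close>])
  qed
  moreover have "weakens (econs k \<Gamma> i) (econs k \<Delta> (upr f i))" for i
    using w by (cases i) (simp_all add: weakens_def)
  ultimately show ?thesis
    using assms by (simp add: renames_def range_upr) auto
qed

lemma renames_mi_env:
  assumes "renames f \<Gamma> \<Delta>" and "\<forall>i. \<Gamma> i \<noteq> Some PL"
  shows "renames f (mi_env \<Gamma>) (mi_env \<Delta>)" and "\<forall>j. \<Delta> j \<noteq> Some PL"
proof -
  have *: "weakens (\<Gamma> i) (\<Delta> (f i))" "\<Gamma> i \<noteq> Some PL" for i
    using assms by (auto simp: renames_def)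
  have "weakens (mi_env \<Gamma> i) (mi_env \<Delta> (f i))" for i
  proof -
    consider "\<Gamma> i = \<Delta> (f i)" | "\<Gamma> i = None" "\<not> linear (\<Delta> (f i))"
      using *[of i] by (auto simp: weakens_def)
    then show ?thesis
      by cases (simp_all add: weakens_def linear_def mi_env_def split: option.split pk.split)
  qed
  then show "renames f (mi_env \<Gamma>) (mi_env \<Delta>)"
    using assms by (auto simp: renames_def linear_mi_env) 
  show "\<forall>j. \<Delta> j \<noteq> Some PL"
  proof
    fix j
    show "\<Delta> j \<noteq> Some PL"
    proof (cases "j \<in> range f")
      case True
      then obtain i where "j = f i" by blast
      then show ?thesis using *[of i] by (auto simp: weakens_def)
    next
      case False
      then show ?thesis using assms by (auto simp: renames_def)
    qed
  qed
qed

lemma renames_mc_env: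
  assumes "renames f \<Gamma> \<Delta>" and "\<forall>i. \<Gamma> i \<noteq> Some PL \<and> \<Gamma> i \<noteq> Some PI"
  shows "renames f (mc_env \<Gamma>) (mc_env \<Delta>)" and "\<forall>j. \<Delta> j \<noteq> Some PL \<and> \<Delta> j \<noteq> Some PI"
proof -
  have *: "weakens (\<Gamma> i) (\<Delta> (f i))" "\<Gamma> i \<noteq> Some PL" "\<Gamma> i \<noteq> Some PI" for i
    using assms by (auto simp: renames_def)
  have "weakens (mc_env \<Gamma> i) (mc_env \<Delta> (f i))" for i
  proof -
    consider "\<Gamma> i = \<Delta> (f i)" | "\<Gamma> i = None" "\<not> linear (\<Delta> (f i))"
      using *[of i] by (auto simp: weakens_def)
    then show ?thesis
      by cases (simp_all add: weakens_def linear_def mc_env_def split: option.split pk.split)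
  qed
  then show "renames f (mc_env \<Gamma>) (mc_env \<Delta>)"
    using assms by (auto simp: renames_def not_linear_mc_env)
  show "\<forall>j. \<Delta> j \<noteq> Some PL \<and> \<Delta> j \<noteq> Some PI"
  proof
    fix j
    show "\<Delta> j \<noteq> Some PL \<and> \<Delta> j \<noteq> Some PI"
    proof (cases "j \<in> range f")
      case True
      then obtain i where "j = f i" by blast
      then show ?thesis using *[of i] by (auto simp: weakens_def)
    next
      case False
      then show ?thesis using assms by (auto simp: renames_def)
    qed
  qed
qed

lemma renames_split:
  assumes "renames f \<Gamma> \<Delta>" and "esplit \<Gamma> \<Gamma>1 \<Gamma>2"
  obtains \<Delta>1 \<Delta>2 where "esplit \<Delta> \<Delta>1 \<Delta>2" and "renames f \<Gamma>1 \<Delta>1" and "renames f \<Gamma>2 \<Delta>2"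
proof -
  \<comment> \<open>A linear entry of \<open>\<Delta>\<close> comes unchanged from
    \<open>\<Gamma>\<close> and follows its owner there. All other entries, including those changed
    from PL to PH, are given to both halves.\<close>
  define part where "part \<Gamma>' j = (if linear (\<Delta> j) then \<Gamma>' (inv f j) else \<Delta> j)" for \<Gamma>' :: env and j
  have "inj f" using assms by (simp add: renames_def)
  then have inv: "inv f (f i) = i" for i by simp
  have *: "weakens (\<Gamma> i) (\<Delta> (f i))" "osplit (\<Gamma> i) (\<Gamma>1 i) (\<Gamma>2 i)" for i
    using assms by (auto simp: renames_def esplit_iff)
  have out: "\<not> linear (\<Delta> j)" if "j \<notin> range f" for j
    using assms that by (auto simp: renames_def)
  have split: "esplit \<Delta> (part \<Gamma>1) (part \<Gamma>2)"
    unfolding esplit_iff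
  proof
    fix j
    show "osplit (\<Delta> j) (part \<Gamma>1 j) (part \<Gamma>2 j)"
    proof (cases "linear (\<Delta> j)")
      case True
      with out obtain i where i: "j = f i" by blast
      from True *[of i] have "\<Gamma> i = \<Delta> j"
        by (auto simp: i weakens_def)
      with True *[of i] show ?thesis by (simp add: part_def i inv)
    qed (simp add: part_def osplit_def)
  qed
  have w: "weakens (\<Gamma>1 i) (part \<Gamma>1 (f i))" "weakens (\<Gamma>2 i) (part \<Gamma>2 (f i))" for i
    using *[of i] by (auto simp: part_def inv weakens_def osplit_def split: if_splits)
  from w have "renames f \<Gamma>1 (part \<Gamma>1)" "renames f \<Gamma>2 (part \<Gamma>2)"
    using \<open>inj f\<close> out by (auto simp: renames_def part_def)
  with split show ?thesis by (rule that)
qed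

text \<open>One layer of the derivation. At \<open>CBox\<close> the premise is not treated by
  induction but handed to the parameter, which is the invariant used by the coinduction in
  \<open>typed_ren\<close>.\<close>

lemma typ_step_ren:
  "typ_step typed \<Gamma> M \<Longrightarrow> renames f \<Gamma> \<Delta> \<Longrightarrow>
    typ_step (\<lambda>\<Delta> N. \<exists>\<Gamma> M f. typed \<Gamma> M \<and> renames f \<Gamma> \<Delta> \<and> N = ren f M) \<Delta> (ren f M)"
proof (induction arbitrary: f \<Delta> rule: typ_step.induct)
  case (tvar \<Gamma> i)
  have w: "weakens (\<Gamma> i) (\<Delta> (f i))" for i
    using tvar.prems by (auto simp: renames_def)
  have "\<Delta> (f i) \<in> {Some PL, Some PH, Some PD}"
    using w[of i] tvar.hyps(1) by (auto simp: weakens_def)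
  moreover have "\<not> linear (\<Delta> j)" if "j \<noteq> f i" for j
  proof (cases "j \<in> range f")
    case True
    then obtain i' where i': "j = f i'" by blast
    with that have "i' \<noteq> i" by auto
    then have "\<not> linear (\<Gamma> i')" using tvar.hyps(2) by auto
    then show ?thesis using w[of i'] by (auto simp: i' weakens_def)
  next
    case False
    then show ?thesis using tvar.prems by (auto simp: renames_def)
  qed
  then have "\<forall>j. j \<noteq> f i \<longrightarrow> \<Delta> j \<in> {None, Some PH, Some PC, Some PD}"
    using not_linear_cases by blast
  ultimately show ?case by (simp add: typ_step.tvar)
next
  case (tapp \<Gamma> \<Gamma>1 \<Gamma>2 M N)
  from tapp.prems tapp.hyps(1) obtain \<Delta>1 \<Delta>2
    where "esplit \<Delta> \<Delta>1 \<Delta>2" "renames f \<Gamma>1 \<Delta>1" "renames f \<Gamma>2 \<Delta>2"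
    by (rule renames_split)
  then show ?case using tapp.IH by (auto intro: typ_step.tapp)
next
  case (tll \<Gamma> M)
  then show ?case by (auto intro!: typ_step.tll renames_econs)
next
  case (tli1 \<Gamma> M)
  then show ?case by (auto intro!: typ_step.tli1 renames_econs)
next
  case (tli2 \<Gamma> M)
  then show ?case by (auto intro!: typ_step.tli2 renames_econs)
next
  case (tlc \<Gamma> M)
  then show ?case by (auto intro!: typ_step.tlc renames_econs)
next
  case (tmi \<Gamma> M)
  from renames_mi_env[OF tmi.prems tmi.hyps(1)] tmi.IH show ?case
    by (simp add: typ_step.tmi)
next
  case (tmc \<Gamma> M)
  from renames_mc_env[OF tmc.prems tmc.hyps(1)] tmc.hyps(2) show ?case
    by (auto intro!: typ_step.tmc)
qed

lemma typed_coinduct: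
  assumes "X \<Gamma> M" and "\<And>\<Gamma> M. X \<Gamma> M \<Longrightarrow> typ_step X \<Gamma> M"
  shows "typed \<Gamma> M"
  using assms(1)
proof (coinduction arbitrary: \<Gamma> M rule: typed.coinduct)
  case typed
  from assms(2)[OF this] have "typ_step (\<lambda>\<Gamma> M. X \<Gamma> M \<or> typed \<Gamma> M) \<Gamma> M"
    by (rule typ_step_mono[rule_format, rotated]) simp
  then show ?case by simp
qed

lemma typed_ren:
  assumes "typed \<Gamma> M" and "renames f \<Gamma> \<Delta>"
  shows "typed \<Delta> (ren f M)"
proof (rule typed_coinduct)
  show "\<exists>\<Gamma> M' f'. typed \<Gamma> M' \<and> renames f' \<Gamma> \<Delta> \<and> ren f M = ren f' M'"
    using assms by blast
next
  fix \<Delta> N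
  assume "\<exists>\<Gamma> M f. typed \<Gamma> M \<and> renames f \<Gamma> \<Delta> \<and> N = ren f M"
  then show "typ_step (\<lambda>\<Delta> N. \<exists>\<Gamma> M f. typed \<Gamma> M \<and> renames f \<Gamma> \<Delta> \<and> N = ren f M) \<Delta> N"
    using typ_step_ren typed_iff by blast
qed

lemma typed_weaken:
  assumes "typed \<Gamma> M" and "\<And>i. weakens (\<Gamma> i) (\<Delta> i)"
  shows "typed \<Delta> M"
  using typed_ren[OF assms(1), of "\<lambda>i. i" \<Delta>] assms(2) by (simp add: renames_def ren_id inj_def)

lemma typed_ren_Suc:
  assumes "typed \<Gamma> M" and "\<not> linear k"
  shows "typed (case_nat k \<Gamma>) (ren Suc M)"
proof (rule typed_ren[OF assms(1)])
  have "\<not> linear (case_nat k \<Gamma> j)" if "j \<notin> range Suc" for j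
    using that assms(2) by (cases j) auto
  then show "renames Suc \<Gamma> (case_nat k \<Gamma>)"
    by (auto simp: renames_def weakens_def)
qed

section \<open>Substitution\<close>

text \<open>The argument of a dagger variable may be used right here as well as below further
  coinductive boxes, so it may only rely on variables that are daggers already.
  \<open>mc_env\<close> would be too generous, since it also promotes PC to PD.\<close>

definition dagger_env :: "env \<Rightarrow> env" where
  "dagger_env \<Gamma> i = (if \<Gamma> i = Some PD then Some PD else None)"

text \<open>The term \<^term>\<open>B\<close> may be substituted for a variable of kind \<^term>\<open>k\<close>, using the
  part \<^term>\<open>\<Delta>\<close> of the target environment. The environment in which \<^term>\<open>B\<close> itself is
  typed is the one at the place where the variable will be found: at the surface (PL, PH, PD),
  below one inductive box (PI), or below a coinductive box (PC).\<close>

definition argument :: "pk option \<Rightarrow> env \<Rightarrow> trm \<Rightarrow> bool" where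
  "argument k \<Delta> B \<longleftrightarrow> (k \<noteq> Some PL \<longrightarrow> (\<forall>i. \<Delta> i \<noteq> Some PL)) \<and>
    (\<not> linear k \<longrightarrow> (\<forall>i. \<not> linear (\<Delta> i))) \<and>
    (k = Some PL \<or> k = Some PH \<longrightarrow> typed \<Delta> B) \<and> (k = Some PI \<longrightarrow> typed (mi_env \<Delta>) B) \<and>
    (k = Some PC \<longrightarrow> typed (mc_env \<Delta>) B) \<and> (k = Some PD \<longrightarrow> typed (dagger_env \<Delta>) B)"

text \<open>Here \<^term>\<open>g\<close> lists the variables other than \<^term>\<open>x\<close>, so that \<^term>\<open>\<sigma>\<close> is an
  iterated lifting of a substitution of the form \<^term>\<open>sub1 B\<close>.\<close>

definition substitutes :: "(nat \<Rightarrow> trm) \<Rightarrow> env \<Rightarrow> env \<Rightarrow> bool" where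
  "substitutes \<sigma> \<Gamma> \<Delta> \<longleftrightarrow> (\<exists>x g \<Delta>'. range g = - {x} \<and> (\<forall>j. \<sigma> (g j) = Var j) \<and>
    esplit \<Delta> (\<lambda>j. \<Gamma> (g j)) \<Delta>' \<and> argument (\<Gamma> x) \<Delta>' (\<sigma> x))"

lemma substitutesE:
  assumes "substitutes \<sigma> \<Gamma> \<Delta>"
  obtains x g \<Delta>' where "range g = - {x}" and "\<And>j. \<sigma> (g j) = Var j"
    and "esplit \<Delta> (\<lambda>j. \<Gamma> (g j)) \<Delta>'" and "argument (\<Gamma> x) \<Delta>' (\<sigma> x)"
  using assms unfolding substitutes_def by blast

lemma range_cases:
  assumes "range g = - {x}"
  obtains "i = x" | j where "i = g j"
  using assms by (metis ComplI imageE singletonD)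

lemma argument_ren_Suc:
  assumes "argument k \<Delta> B" and "\<not> linear l"
  shows "argument k (case_nat l \<Delta>) (ren Suc B)"
proof -
  have mi: "mi_env (case_nat l \<Delta>) = case_nat (mi_env (\<lambda>_. l) 0) (mi_env \<Delta>)"
    by (rule fun_eq_0_SucI) (simp_all add: mi_env_def)
  have mc: "mc_env (case_nat l \<Delta>) = case_nat (mc_env (\<lambda>_. l) 0) (mc_env \<Delta>)"
    by (rule fun_eq_0_SucI) (simp_all add: mc_env_def)
  have dag: "dagger_env (case_nat l \<Delta>) = case_nat (dagger_env (\<lambda>_. l) 0) (dagger_env \<Delta>)"
    by (rule fun_eq_0_SucI) (simp_all add: dagger_env_def)
  have nl: "\<not> linear (mi_env (\<lambda>_. l) 0)" "\<not> linear (mc_env (\<lambda>_. l) 0)"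
    "\<not> linear (dagger_env (\<lambda>_. l) 0)" "l \<noteq> Some PL"
    using assms(2) by (auto simp: linear_mi_env not_linear_mc_env dagger_env_def)
  show ?thesis
    using assms nl unfolding argument_def mi mc dag
    by (auto intro!: typed_ren_Suc split: nat.split)
qed

lemma substitutes_econs:
  assumes "substitutes \<sigma> \<Gamma> \<Delta>" shows "substitutes (ups \<sigma>) (econs k \<Gamma>) (econs k \<Delta>)"
proof -
  obtain x g \<Delta>' where g: "range g = - {x}" "\<And>j. \<sigma> (g j) = Var j"
    and \<Delta>': "esplit \<Delta> (\<lambda>j. \<Gamma> (g j)) \<Delta>'" "argument (\<Gamma> x) \<Delta>' (\<sigma> x)"
    using assms by (rule substitutesE) blast
  let ?l = "if linear (Some k) then None else Some k"
  have "range (upr g) = - {Suc x}"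
    using g(1) range_upr[of _ g] by auto
  moreover have "ups \<sigma> (upr g j) = Var j" for j
    by (cases j) (simp_all add: g)
  moreover have "(\<lambda>j. econs k \<Gamma> (upr g j)) = econs k (\<lambda>j. \<Gamma> (g j))"
    by (rule fun_eq_0_SucI) simp_all
  with esplit_econs[OF \<Delta>'(1), of k]
  have "esplit (econs k \<Delta>) (\<lambda>j. econs k \<Gamma> (upr g j)) (case_nat ?l \<Delta>')" by simp
  moreover have "argument (econs k \<Gamma> (Suc x)) (case_nat ?l \<Delta>') (ups \<sigma> (Suc x))"
    using argument_ren_Suc[OF \<Delta>'(2), of ?l] by simp
  ultimately show ?thesis unfolding substitutes_def by blast
qed

lemma substitutes_mi_env:
  assumes "substitutes \<sigma> \<Gamma> \<Delta>" and noPL: "\<forall>i. \<Gamma> i \<noteq> Some PL"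
  shows "substitutes \<sigma> (mi_env \<Gamma>) (mi_env \<Delta>)" and "\<forall>j. \<Delta> j \<noteq> Some PL"
proof -
  obtain x g \<Delta>' where g: "range g = - {x}" "\<And>j. \<sigma> (g j) = Var j"
    and \<Delta>': "esplit \<Delta> (\<lambda>j. \<Gamma> (g j)) \<Delta>'" "argument (\<Gamma> x) \<Delta>' (\<sigma> x)"
    using assms(1) by (rule substitutesE) blast
  have "mi_env (\<lambda>j. \<Gamma> (g j)) = (\<lambda>j. mi_env \<Gamma> (g j))"
    by (simp add: mi_env_def fun_eq_iff)
  with esplit_mi_env[OF \<Delta>'(1)] have "esplit (mi_env \<Delta>) (\<lambda>j. mi_env \<Gamma> (g j)) (mi_env \<Delta>')"
    by simp
  moreover have "dagger_env (mi_env \<Delta>') = dagger_env \<Delta>'"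
    by (auto simp: fun_eq_iff dagger_env_def mi_env_eq_Some_iff)
  then have "argument (mi_env \<Gamma> x) (mi_env \<Delta>') (\<sigma> x)"
    using \<Delta>'(2) noPL unfolding argument_def linear_mi_env mi_env_eq_Some_iff
    by (auto simp: linear_def)
  ultimately show "substitutes \<sigma> (mi_env \<Gamma>) (mi_env \<Delta>)"
    unfolding substitutes_def using g by blast
  show "\<forall>j. \<Delta> j \<noteq> Some PL"
  proof
    fix j
    have "osplit (\<Delta> j) (\<Gamma> (g j)) (\<Delta>' j)" using \<Delta>'(1) by (simp add: esplit_iff)
    moreover have "\<Delta>' j \<noteq> Some PL" using \<Delta>'(2) noPL by (simp add: argument_def)
    ultimately show "\<Delta> j \<noteq> Some PL" using noPL by (auto simp: osplit_def)
  qed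
qed

lemma substitutes_mc_env:
  assumes "substitutes \<sigma> \<Gamma> \<Delta>" and nl: "\<forall>i. \<Gamma> i \<noteq> Some PL \<and> \<Gamma> i \<noteq> Some PI"
  shows "substitutes \<sigma> (mc_env \<Gamma>) (mc_env \<Delta>)" and "\<forall>j. \<Delta> j \<noteq> Some PL \<and> \<Delta> j \<noteq> Some PI"
proof -
  obtain x g \<Delta>' where g: "range g = - {x}" "\<And>j. \<sigma> (g j) = Var j"
    and \<Delta>': "esplit \<Delta> (\<lambda>j. \<Gamma> (g j)) \<Delta>'" "argument (\<Gamma> x) \<Delta>' (\<sigma> x)"
    using assms(1) by (rule substitutesE) blast
  have "mc_env (\<lambda>j. \<Gamma> (g j)) = (\<lambda>j. mc_env \<Gamma> (g j))"
    by (simp add: mc_env_def fun_eq_iff)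
  with esplit_mc_env[OF \<Delta>'(1)] have "esplit (mc_env \<Delta>) (\<lambda>j. mc_env \<Gamma> (g j)) (mc_env \<Delta>')"
    by simp
  moreover have "argument (mc_env \<Gamma> x) (mc_env \<Delta>') (\<sigma> x)"
  proof -
    have "dagger_env (mc_env \<Delta>') = mc_env \<Delta>'"
      by (rule ext) (auto simp: dagger_env_def mc_env_def split: option.split pk.split)
    \<comment> \<open>A dagger variable stays a dagger below the box. Its argument is weakened by
      the coinductive variables that have just become daggers.\<close>
    moreover have "typed (mc_env \<Delta>') (\<sigma> x)" if "\<Gamma> x = Some PD"
    proof (rule typed_weaken)
      show "typed (dagger_env \<Delta>') (\<sigma> x)" using that \<Delta>'(2) by (simp add: argument_def)
      show "weakens (dagger_env \<Delta>' i) (mc_env \<Delta>' i)" for i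
        by (auto simp: weakens_def dagger_env_def mc_env_def split: option.split pk.split)
    qed
    ultimately show ?thesis
      using \<Delta>'(2) unfolding argument_def mc_env_eq_Some_iff
      by (auto simp: not_linear_mc_env)
  qed
  ultimately show "substitutes \<sigma> (mc_env \<Gamma>) (mc_env \<Delta>)"
    unfolding substitutes_def using g by blast
  show "\<forall>j. \<Delta> j \<noteq> Some PL \<and> \<Delta> j \<noteq> Some PI"
  proof
    fix j
    have "osplit (\<Delta> j) (\<Gamma> (g j)) (\<Delta>' j)" using \<Delta>'(1) by (simp add: esplit_iff)
    moreover have "\<not> linear (\<Delta>' j)" using \<Delta>'(2) nl by (simp add: argument_def linear_def)
    ultimately show "\<Delta> j \<noteq> Some PL \<and> \<Delta> j \<noteq> Some PI"
      using nl by (auto simp: osplit_def)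
  qed
qed

text \<open>If the kind of \<open>x\<close> is linear, the argument goes with \<open>x\<close> to
  the left, and on the right \<open>x\<close> is absent and nothing is asked of
  \<open>\<sigma> x\<close>. Otherwise the environment of the argument is nonlinear, so both sides
  can use it.\<close>

lemma substitutes_split_left:
  assumes g: "range g = - {x}" "\<And>j. \<sigma> (g j) = Var j"
    and \<Delta>': "esplit \<Delta> (\<lambda>j. \<Gamma> (g j)) \<Delta>'" "argument (\<Gamma> x) \<Delta>' (\<sigma> x)"
    and \<Gamma>: "esplit \<Gamma> \<Gamma>1 \<Gamma>2" "\<Gamma>1 x = \<Gamma> x"
  shows "\<exists>\<Delta>1 \<Delta>2. esplit \<Delta> \<Delta>1 \<Delta>2 \<and> substitutes \<sigma> \<Gamma>1 \<Delta>1 \<and> substitutes \<sigma> \<Gamma>2 \<Delta>2"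
proof -
  have "esplit (\<lambda>j. \<Gamma> (g j)) (\<lambda>j. \<Gamma>1 (g j)) (\<lambda>j. \<Gamma>2 (g j))"
    using \<Gamma> by (simp add: esplit_iff)
  then obtain \<Delta>1 where \<Delta>1: "esplit \<Delta> \<Delta>1 (\<lambda>j. \<Gamma>2 (g j))" "esplit \<Delta>1 (\<lambda>j. \<Gamma>1 (g j)) \<Delta>'"
    using \<Delta>'(1) esplit_assoc by blast
  have "substitutes \<sigma> \<Gamma>1 \<Delta>1"
    unfolding substitutes_def using g \<Delta>1(2) \<Delta>'(2) \<Gamma>(2) by metis
  moreover have "substitutes \<sigma> \<Gamma>2 (\<lambda>j. \<Gamma>2 (g j))"
  proof -
    \<comment> \<open>The nonlinear part of the right environment. It coincides with
      \<open>\<Delta>'\<close> if the kind of \<open>x\<close> is nonlinear, and otherwise serves as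
      a trivial environment for the absent variable.\<close>
    let ?\<Delta> = "\<lambda>j. if linear (\<Gamma>2 (g j)) then None else \<Gamma>2 (g j)"
    have "esplit (\<lambda>j. \<Gamma>2 (g j)) (\<lambda>j. \<Gamma>2 (g j)) ?\<Delta>"
      by (simp add: esplit_iff osplit_def)
    moreover have "argument (\<Gamma>2 x) ?\<Delta> (\<sigma> x)"
    proof (cases "linear (\<Gamma> x)")
      case True
      moreover have "osplit (\<Gamma> x) (\<Gamma>1 x) (\<Gamma>2 x)" using \<Gamma>(1) by (simp add: esplit_iff)
      ultimately have "\<Gamma>2 x = None" using \<Gamma>(2) by (auto simp: osplit_def)
      then show ?thesis by (auto simp: argument_def)
    next
      case False
      moreover have "osplit (\<Gamma> x) (\<Gamma>1 x) (\<Gamma>2 x)" using \<Gamma>(1) by (simp add: esplit_iff)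
      ultimately have "\<Gamma>2 x = \<Gamma> x" by (auto simp: osplit_def)
      moreover have "?\<Delta> = \<Delta>'"
      proof
        fix j
        have "osplit (\<Delta> j) (\<Gamma> (g j)) (\<Delta>' j)" "osplit (\<Gamma> (g j)) (\<Gamma>1 (g j)) (\<Gamma>2 (g j))"
          using \<Delta>'(1) \<Gamma>(1) by (simp_all add: esplit_iff)
        moreover have "\<not> linear (\<Delta>' j)" using \<Delta>'(2) False by (simp add: argument_def)
        ultimately show "?\<Delta> j = \<Delta>' j" by (auto simp: osplit_def split: if_splits)
      qed
      ultimately show ?thesis using \<Delta>'(2) by simp
    qed
    ultimately show ?thesis unfolding substitutes_def using g by blast
  qed
  ultimately show ?thesis using \<Delta>1(1) by blast
qed

lemma substitutes_split:
  assumes "substitutes \<sigma> \<Gamma> \<Delta>" and "esplit \<Gamma> \<Gamma>1 \<Gamma>2"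
  obtains \<Delta>1 \<Delta>2 where "esplit \<Delta> \<Delta>1 \<Delta>2" and "substitutes \<sigma> \<Gamma>1 \<Delta>1" and "substitutes \<sigma> \<Gamma>2 \<Delta>2"
proof -
  obtain x g \<Delta>' where sub: "range g = - {x}" "\<And>j. \<sigma> (g j) = Var j"
    "esplit \<Delta> (\<lambda>j. \<Gamma> (g j)) \<Delta>'" "argument (\<Gamma> x) \<Delta>' (\<sigma> x)"
    using assms(1) by (rule substitutesE) blast
  have "osplit (\<Gamma> x) (\<Gamma>1 x) (\<Gamma>2 x)" using assms(2) by (simp add: esplit_iff)
  then consider "\<Gamma>1 x = \<Gamma> x" | "\<Gamma>2 x = \<Gamma> x" by (auto simp: osplit_def split: if_splits)
  then show ?thesis
  proof cases
    case 1
    from substitutes_split_left[OF sub assms(2) 1] show ?thesis using that by blast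
  next
    case 2
    from substitutes_split_left[OF sub esplit_commute[OF assms(2)] 2] show ?thesis
      using that esplit_commute by blast
  qed
qed

lemma typ_step_typed_mono:
  "typed \<Gamma> M \<Longrightarrow> (\<And>\<Gamma> M. typed \<Gamma> M \<Longrightarrow> X \<Gamma> M) \<Longrightarrow> typ_step X \<Gamma> M"
  using typ_step_mono[of typed X] typed_iff by blast

text \<open>The disjunct \<open>typed \<Delta> N\<close> is for the variable case: once the argument
  has been inserted, the rest of the derivation is its own and no substitution remains.\<close>

lemma typ_step_subst:
  "typ_step typed \<Gamma> M \<Longrightarrow> substitutes \<sigma> \<Gamma> \<Delta> \<Longrightarrow>
    typ_step (\<lambda>\<Delta> N. typed \<Delta> N \<or> (\<exists>\<Gamma> M \<sigma>. typed \<Gamma> M \<and> substitutes \<sigma> \<Gamma> \<Delta> \<and> N = subst \<sigma> M))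
      \<Delta> (subst \<sigma> M)"
proof (induction arbitrary: \<sigma> \<Delta> rule: typ_step.induct)
  case (tvar \<Gamma> i)
  obtain x g \<Delta>' where g: "range g = - {x}" "\<And>j. \<sigma> (g j) = Var j"
    and \<Delta>': "esplit \<Delta> (\<lambda>j. \<Gamma> (g j)) \<Delta>'" "argument (\<Gamma> x) \<Delta>' (\<sigma> x)"
    using tvar.prems by (rule substitutesE) blast
  have nl: "\<not> linear (\<Gamma> j)" if "j \<noteq> i" for j
    using that tvar.hyps(2) by (auto simp: linear_def)
  from g(1) have "typed \<Delta> (\<sigma> i)"
  proof (cases rule: range_cases[of _ _ i])
    case 1
    \<comment> \<open>The variable rule leaves only nonlinear variables besides \<open>i\<close>, so
      the argument owns the entire target environment.\<close>
    have "\<forall>j. \<not> linear (\<Gamma> (g j))" using g(1) nl 1 by blast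
    with \<Delta>'(1) have "\<Delta>' = \<Delta>" by (rule esplit_nonlinear)
    moreover have "typed \<Delta>' (\<sigma> x)"
    proof (cases "\<Gamma> x = Some PD")
      case True
      show ?thesis
      proof (rule typed_weaken)
        show "typed (dagger_env \<Delta>') (\<sigma> x)" using True \<Delta>'(2) by (simp add: argument_def)
        show "weakens (dagger_env \<Delta>' i) (\<Delta>' i)" for i
          using True \<Delta>'(2) by (auto simp: weakens_def dagger_env_def argument_def)
      qed
    next
      case False
      then show ?thesis using \<Delta>'(2) tvar.hyps(1) 1 by (auto simp: argument_def)
    qed
    ultimately show ?thesis by (simp add: 1)
  next
    case (2 j)
    have "x \<noteq> i" using g(1) 2 by auto
    then have "\<forall>i. \<not> linear (\<Delta>' i)" using \<Delta>'(2) nl[of x] by (auto simp: argument_def)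
    with \<Delta>'(1) have "\<Delta> = (\<lambda>j. \<Gamma> (g j))" using esplit_commute esplit_nonlinear by blast
    moreover have "g j' \<noteq> g j" if "j' \<noteq> j" for j'
      using that g(2) by (metis trm.inject(1))
    moreover have "\<Gamma> (g j') \<in> {None, Some PH, Some PC, Some PD}" if "j' \<noteq> j" for j'
      using tvar.hyps(2) 2 that calculation(2)[OF that] by blast
    ultimately show ?thesis
      using tvar.hyps(1) 2 by (simp add: g(2) typed_intros(1))
  qed
  then show ?case by (auto intro: typ_step_typed_mono)
next
  case (tapp \<Gamma> \<Gamma>1 \<Gamma>2 M N)
  from tapp.prems tapp.hyps(1) obtain \<Delta>1 \<Delta>2
    where "esplit \<Delta> \<Delta>1 \<Delta>2" "substitutes \<sigma> \<Gamma>1 \<Delta>1" "substitutes \<sigma> \<Gamma>2 \<Delta>2"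
    by (rule substitutes_split)
  then show ?case using tapp.IH by (auto intro: typ_step.tapp)
next
  case (tll \<Gamma> M)
  then show ?case by (auto intro!: typ_step.tll substitutes_econs)
next
  case (tli1 \<Gamma> M)
  then show ?case by (auto intro!: typ_step.tli1 substitutes_econs)
next
  case (tli2 \<Gamma> M)
  then show ?case by (auto intro!: typ_step.tli2 substitutes_econs)
next
  case (tlc \<Gamma> M)
  then show ?case by (auto intro!: typ_step.tlc substitutes_econs)
next
  case (tmi \<Gamma> M)
  from substitutes_mi_env[OF tmi.prems tmi.hyps(1)] tmi.IH show ?case
    by (simp add: typ_step.tmi)
next
  case (tmc \<Gamma> M)
  from substitutes_mc_env[OF tmc.prems tmc.hyps(1)] tmc.hyps(2) show ?case
    by (auto intro!: typ_step.tmc)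
qed

lemma typed_subst:
  assumes "typed \<Gamma> M" and "substitutes \<sigma> \<Gamma> \<Delta>"
  shows "typed \<Delta> (subst \<sigma> M)"
proof (rule typed_coinduct)
  let ?X = "\<lambda>\<Delta> N. typed \<Delta> N \<or> (\<exists>\<Gamma> M \<sigma>. typed \<Gamma> M \<and> substitutes \<sigma> \<Gamma> \<Delta> \<and> N = subst \<sigma> M)"
  show "?X \<Delta> (subst \<sigma> M)" using assms by blast
  show "typ_step ?X \<Delta> N" if "?X \<Delta> N" for \<Delta> N
    using that typ_step_subst typ_step_typed_mono[of \<Delta> N ?X] typed_iff by blast
qed

lemma typed_inst:
  assumes "typed (econs k \<Gamma>) M" and "esplit \<Delta> \<Gamma> \<Delta>'" and "argument (Some k) \<Delta>' N"
  shows "typed \<Delta> (inst M N)"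
  unfolding inst_def
proof (rule typed_subst[OF assms(1)])
  have "range Suc = - {0}" by (auto simp: image_iff) (metis not0_implies_Suc)
  then show "substitutes (sub1 N) (econs k \<Gamma>) \<Delta>"
    unfolding substitutes_def using assms
    by (intro exI[of _ 0] exI[of _ Suc] exI[of _ \<Delta>']) simp
qed

section \<open>Surface reduction and subject reduction\<close>

inductive step0 :: "trm \<Rightarrow> trm \<Rightarrow> bool" where
  step0_beta: "beta M N \<Longrightarrow> step0 M N"
| step0_App1: "step0 M M' \<Longrightarrow> step0 (App M N) (App M' N)"
| step0_App2: "step0 N N' \<Longrightarrow> step0 (App M N) (App M N')"
| step0_Lam: "step0 M M' \<Longrightarrow> step0 (Lam M) (Lam M')"
| step0_LamI: "step0 M M' \<Longrightarrow> step0 (LamI M) (LamI M')"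
| step0_LamC: "step0 M M' \<Longrightarrow> step0 (LamC M) (LamC M')"
| step0_IBox: "step0 M M' \<Longrightarrow> step0 (IBox M) (IBox M')"

lemma step0_imp_step: "step0 M N \<Longrightarrow> step M N"
  by (induction rule: step0.induct) (auto intro: step.intros)

text \<open>An inductive variable may be duplicated when the box around it is opened by a
  redex whose bound variable is marked; its pattern then changes from PI to PH.\<close>

definition demotes :: "env \<Rightarrow> env \<Rightarrow> bool" where
  "demotes \<Gamma> \<Gamma>' \<longleftrightarrow> (\<forall>i. \<Gamma>' i = \<Gamma> i \<or> \<Gamma> i = Some PI \<and> \<Gamma>' i = Some PH)"

lemma demotes_refl: "demotes \<Gamma> \<Gamma>"
  by (simp add: demotes_def)

lemma demotes_trans:
  assumes "demotes \<Gamma> \<Gamma>'" and "demotes \<Gamma>' \<Gamma>''" shows "demotes \<Gamma> \<Gamma>''"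
  unfolding demotes_def
proof
  fix i
  show "\<Gamma>'' i = \<Gamma> i \<or> \<Gamma> i = Some PI \<and> \<Gamma>'' i = Some PH"
    using assms[unfolded demotes_def, THEN spec[of _ i]] by auto
qed

lemma demotes_eq: "demotes \<Gamma> \<Gamma>' \<Longrightarrow> \<forall>i. \<Gamma> i \<noteq> Some PI \<Longrightarrow> \<Gamma>' = \<Gamma>"
  by (auto simp: demotes_def fun_eq_iff)

lemma demotes_dom: "demotes \<Gamma> \<Gamma>' \<Longrightarrow> dom \<Gamma>' = dom \<Gamma>"
  unfolding demotes_def dom_def by (metis option.distinct(1))

lemma demotes_econsE:
  assumes "demotes (econs k \<Gamma>) \<Gamma>'"
  obtains k' \<Delta> where "\<Gamma>' = econs k' \<Delta>" and "demotes \<Gamma> \<Delta>" and "k' = k \<or> k = PI \<and> k' = PH"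
proof -
  have *: "\<Gamma>' i = econs k \<Gamma> i \<or> econs k \<Gamma> i = Some PI \<and> \<Gamma>' i = Some PH" for i
    using assms by (simp add: demotes_def)
  obtain k' where k': "\<Gamma>' 0 = Some k'" "k' = k \<or> k = PI \<and> k' = PH"
    using *[of 0] by auto
  have "\<Gamma>' = econs k' (\<lambda>i. \<Gamma>' (Suc i))"
    by (rule fun_eq_0_SucI) (simp_all add: k')
  moreover have "demotes \<Gamma> (\<lambda>i. \<Gamma>' (Suc i))"
    using *[of "Suc _"] by (simp add: demotes_def)
  ultimately show ?thesis using k'(2) that by blast
qed

text \<open>A variable changed from PI to PH ceases to be split. It must be marked in the whole
  environment and added, as a nonlinear variable, to the other component, which previously lacked
  it.\<close>

lemma esplit_demotes:
  assumes "esplit \<Gamma> \<Gamma>1 \<Gamma>2" and "demotes \<Gamma>1 \<Gamma>1'"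
  obtains \<Gamma>' \<Gamma>2' where "demotes \<Gamma> \<Gamma>'" and "esplit \<Gamma>' \<Gamma>1' \<Gamma>2'" and "\<forall>i. weakens (\<Gamma>2 i) (\<Gamma>2' i)"
proof -
  have "\<exists>a b. (a = \<Gamma> i \<or> \<Gamma> i = Some PI \<and> a = Some PH) \<and> osplit a (\<Gamma>1' i) b \<and> weakens (\<Gamma>2 i) b" for i
  proof (cases "\<Gamma>1' i = \<Gamma>1 i")
    case True
    then show ?thesis using assms(1) by (auto simp: esplit_iff weakens_def)
  next
    case False
    then have "\<Gamma>1 i = Some PI" "\<Gamma>1' i = Some PH" using assms(2) by (auto simp: demotes_def)
    moreover have "osplit (\<Gamma> i) (\<Gamma>1 i) (\<Gamma>2 i)" using assms(1) by (simp add: esplit_iff)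
    ultimately have "\<Gamma> i = Some PI" "\<Gamma>2 i = None"
      by (auto simp: osplit_def linear_def split: if_splits)
    then show ?thesis using \<open>\<Gamma>1' i = Some PH\<close> by (auto simp: osplit_def weakens_def)
  qed
  then obtain \<Gamma>' \<Gamma>2' where
    "\<forall>i. (\<Gamma>' i = \<Gamma> i \<or> \<Gamma> i = Some PI \<and> \<Gamma>' i = Some PH) \<and> osplit (\<Gamma>' i) (\<Gamma>1' i) (\<Gamma>2' i) \<and>
      weakens (\<Gamma>2 i) (\<Gamma>2' i)"
    by metis
  then show ?thesis using that by (auto simp: demotes_def esplit_iff)
qed

text \<open>The only contraction that changes the environment. A marked variable may occur several
  times in \<open>M\<close>, so \<open>N\<close> may be copied to the surface, and the variables it
  used once through the inductive box may now occur repeatedly.\<close>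

lemma typed_beta_LamI_marked:
  assumes "esplit \<Gamma> \<Gamma>1 \<Gamma>2" and M: "typed (econs PH \<Gamma>1) M"
    and noPL: "\<forall>i. \<Gamma>2 i \<noteq> Some PL" and N: "typed (mi_env \<Gamma>2) N"
  shows "\<exists>\<Gamma>'. demotes \<Gamma> \<Gamma>' \<and> typed \<Gamma>' (inst M N)"
proof -
  \<comment> \<open>Inside the box these PI variables are PL, and PL weakens to PH; so
    \<open>N\<close> is typed in this nonlinear environment.\<close>
  define \<Gamma>2' where "\<Gamma>2' i = (if \<Gamma>2 i = Some PI then Some PH else \<Gamma>2 i)" for i
  have "demotes \<Gamma>2 \<Gamma>2'" by (simp add: demotes_def \<Gamma>2'_def)
  with esplit_commute[OF assms(1)] obtain \<Gamma>' \<Gamma>1'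
    where \<Gamma>': "demotes \<Gamma> \<Gamma>'" "esplit \<Gamma>' \<Gamma>2' \<Gamma>1'" "\<forall>i. weakens (\<Gamma>1 i) (\<Gamma>1' i)"
    by (rule esplit_demotes)
  have "weakens (econs PH \<Gamma>1 i) (econs PH \<Gamma>1' i)" for i
    using \<Gamma>'(3) by (cases i) (simp_all add: weakens_def)
  with M have "typed (econs PH \<Gamma>1') M" by (rule typed_weaken)
  moreover have "typed \<Gamma>2' N"
  proof (rule typed_weaken[OF N])
    fix i
    show "weakens (mi_env \<Gamma>2 i) (\<Gamma>2' i)"
      using noPL[rule_format, of i]
      by (auto simp: weakens_def \<Gamma>2'_def mi_env_def split: option.split pk.split)
  qed
  then have "argument (Some PH) \<Gamma>2' N"
    using noPL by (simp add: argument_def \<Gamma>2'_def linear_def)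
  ultimately have "typed \<Gamma>' (inst M N)"
    using esplit_commute[OF \<Gamma>'(2)] by (intro typed_inst)
  with \<Gamma>'(1) show ?thesis by blast
qed

lemma typed_beta:
  assumes "beta M N" and "typed \<Gamma> M"
  shows "\<exists>\<Gamma>'. demotes \<Gamma> \<Gamma>' \<and> typed \<Gamma>' N"
  using assms
proof cases
  case (1 A B)
  from assms(2)[unfolded 1] obtain \<Gamma>1 \<Gamma>2
    where "esplit \<Gamma> \<Gamma>1 \<Gamma>2" "typed (econs PL \<Gamma>1) A" "typed \<Gamma>2 B"
    by (auto elim!: typed_AppE typed_LamE)
  then have "typed \<Gamma> N"
    unfolding 1 by (intro typed_inst) (auto simp: argument_def)
  then show ?thesis using demotes_refl by blast
next
  case (2 A B)
  from assms(2)[unfolded 2] obtain \<Gamma>1 \<Gamma>2 where split: "esplit \<Gamma> \<Gamma>1 \<Gamma>2"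
    and A: "typed (econs PH \<Gamma>1) A \<or> typed (econs PI \<Gamma>1) A"
    and B: "\<forall>i. \<Gamma>2 i \<noteq> Some PL" "typed (mi_env \<Gamma>2) B"
    by (auto elim!: typed_AppE typed_LamIE typed_IBoxE)
  from A show ?thesis
  proof
    assume "typed (econs PH \<Gamma>1) A"
    with split B show ?thesis unfolding 2 by (intro typed_beta_LamI_marked)
  next
    assume "typed (econs PI \<Gamma>1) A"
    with split B have "typed \<Gamma> N"
      unfolding 2 by (intro typed_inst) (auto simp: argument_def)
    then show ?thesis using demotes_refl by blast
  qed
next
  case (3 A B)
  from assms(2)[unfolded 3] obtain \<Gamma>1 \<Gamma>2
    where "esplit \<Gamma> \<Gamma>1 \<Gamma>2" "typed (econs PC \<Gamma>1) A"
      "\<forall>i. \<Gamma>2 i \<noteq> Some PL \<and> \<Gamma>2 i \<noteq> Some PI" "typed (mc_env \<Gamma>2) B"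
    by (auto elim!: typed_AppE typed_LamCE typed_CBoxE)
  then have "typed \<Gamma> N"
    unfolding 3 by (intro typed_inst) (auto simp: argument_def linear_def)
  then show ?thesis using demotes_refl by blast
qed

lemma typed_step0:
  "step0 M N \<Longrightarrow> typed \<Gamma> M \<Longrightarrow> \<exists>\<Gamma>'. demotes \<Gamma> \<Gamma>' \<and> typed \<Gamma>' N"
proof (induction arbitrary: \<Gamma> rule: step0.induct)
  case (step0_beta M N)
  then show ?case by (rule typed_beta)
next
  case (step0_App1 M M' N)
  from step0_App1.prems obtain \<Gamma>1 \<Gamma>2
    where \<Gamma>: "esplit \<Gamma> \<Gamma>1 \<Gamma>2" "typed \<Gamma>1 M" "typed \<Gamma>2 N"
    by (rule typed_AppE)
  with step0_App1.IH obtain \<Gamma>1' where \<Gamma>1': "demotes \<Gamma>1 \<Gamma>1'" "typed \<Gamma>1' M'" by blast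
  from \<Gamma>(1) \<Gamma>1'(1) obtain \<Gamma>' \<Gamma>2'
    where \<Gamma>': "demotes \<Gamma> \<Gamma>'" "esplit \<Gamma>' \<Gamma>1' \<Gamma>2'" "\<forall>i. weakens (\<Gamma>2 i) (\<Gamma>2' i)"
    by (rule esplit_demotes)
  from \<Gamma>(3) \<Gamma>'(3) have "typed \<Gamma>2' N" by (blast intro: typed_weaken)
  with \<Gamma>' \<Gamma>1' show ?case by (blast intro: typed_intros)
next
  case (step0_App2 N N' M)
  from step0_App2.prems obtain \<Gamma>1 \<Gamma>2
    where \<Gamma>: "esplit \<Gamma> \<Gamma>1 \<Gamma>2" "typed \<Gamma>1 M" "typed \<Gamma>2 N"
    by (rule typed_AppE)
  with step0_App2.IH obtain \<Gamma>2' where \<Gamma>2': "demotes \<Gamma>2 \<Gamma>2'" "typed \<Gamma>2' N'" by blast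
  from esplit_commute[OF \<Gamma>(1)] \<Gamma>2'(1) obtain \<Gamma>' \<Gamma>1'
    where \<Gamma>': "demotes \<Gamma> \<Gamma>'" "esplit \<Gamma>' \<Gamma>2' \<Gamma>1'" "\<forall>i. weakens (\<Gamma>1 i) (\<Gamma>1' i)"
    by (rule esplit_demotes)
  from \<Gamma>(2) \<Gamma>'(3) have "typed \<Gamma>1' M" by (blast intro: typed_weaken)
  with \<Gamma>'(1) esplit_commute[OF \<Gamma>'(2)] \<Gamma>2'(2) show ?case by (blast intro: typed_intros)
next
  case (step0_Lam M M')
  then obtain \<Gamma>' where \<Gamma>': "demotes (econs PL \<Gamma>) \<Gamma>'" "typed \<Gamma>' M'" by (blast elim: typed_LamE)
  from \<Gamma>'(1) obtain \<Delta> where "\<Gamma>' = econs PL \<Delta>" "demotes \<Gamma> \<Delta>" by (rule demotes_econsE) auto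
  with \<Gamma>'(2) show ?case by (blast intro: typed_intros)
next
  case (step0_LamI M M')
  from step0_LamI.prems obtain k where k: "k = PH \<or> k = PI" and "typed (econs k \<Gamma>) M"
    by (rule typed_LamIE) blast+
  with step0_LamI.IH obtain \<Gamma>' where \<Gamma>': "demotes (econs k \<Gamma>) \<Gamma>'" "typed \<Gamma>' M'"
    by blast
  \<comment> \<open>If the bound variable itself is demoted, the other typing rule for
    \<open>LamI\<close> binds it.\<close>
  from \<Gamma>'(1) k obtain k' \<Delta> where "\<Gamma>' = econs k' \<Delta>" "demotes \<Gamma> \<Delta>" "k' = PH \<or> k' = PI"
    by (elim demotes_econsE) auto
  with \<Gamma>'(2) show ?case by (blast intro: typed_intros)
next
  case (step0_LamC M M')
  then obtain \<Gamma>' where \<Gamma>': "demotes (econs PC \<Gamma>) \<Gamma>'" "typed \<Gamma>' M'" by (blast elim: typed_LamCE)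
  from \<Gamma>'(1) obtain \<Delta> where "\<Gamma>' = econs PC \<Delta>" "demotes \<Gamma> \<Delta>" by (rule demotes_econsE) auto
  with \<Gamma>'(2) show ?case by (blast intro: typed_intros)
next
  case (step0_IBox M M')
  from step0_IBox.prems have noPL: "\<forall>i. \<Gamma> i \<noteq> Some PL" and "typed (mi_env \<Gamma>) M"
    by (auto elim: typed_IBoxE)
  with step0_IBox.IH obtain \<Gamma>' where "demotes (mi_env \<Gamma>) \<Gamma>'" "typed \<Gamma>' M'" by blast
  \<comment> \<open>Inside the box every PI has become PL, so the reduction there demotes
    nothing.\<close>
  moreover have "\<forall>i. mi_env \<Gamma> i \<noteq> Some PI" by (simp add: mi_env_eq_Some_iff)
  ultimately have "typed (mi_env \<Gamma>) M'" using demotes_eq by blast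
  with noPL have "typed \<Gamma> (IBox M')" by (rule typed_intros)
  then show ?case using demotes_refl by blast
qed

lemma typed_step0s:
  "step0\<^sup>*\<^sup>* M N \<Longrightarrow> typed \<Gamma> M \<Longrightarrow> \<exists>\<Gamma>'. demotes \<Gamma> \<Gamma>' \<and> typed \<Gamma>' N"
  by (induction rule: rtranclp_induct) (blast intro: demotes_refl demotes_trans dest: typed_step0)+

text \<open>The environment is hidden because reduction and passing to subterms both change it. The
  finite domain required by \<open>lterm\<close> is recovered at the end by
  \<open>demotes_dom\<close>.\<close>

definition well_typed :: "trm \<Rightarrow> bool" where
  "well_typed M \<longleftrightarrow> (\<exists>\<Gamma>. typed \<Gamma> M)"

lemma well_typed_step0s: "well_typed M \<Longrightarrow> step0\<^sup>*\<^sup>* M N \<Longrightarrow> well_typed N"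
  using typed_step0s unfolding well_typed_def by blast

lemma well_typed_sub:
  "well_typed (App M N) \<Longrightarrow> well_typed M" "well_typed (App M N) \<Longrightarrow> well_typed N"
  "well_typed (Lam M) \<Longrightarrow> well_typed M" "well_typed (LamI M) \<Longrightarrow> well_typed M"
  "well_typed (LamC M) \<Longrightarrow> well_typed M" "well_typed (IBox M) \<Longrightarrow> well_typed M"
  "well_typed (CBox M) \<Longrightarrow> well_typed M"
  unfolding well_typed_def
  by (blast elim: typed_AppE typed_LamE typed_LamIE typed_LamCE typed_IBoxE typed_CBoxE)+

section \<open>Free occurrences: anywhere (\<open>fv\<close>), at the surface (\<open>occ0\<close>),
  inside a coinductive box (\<open>occ1\<close>)\<close>

inductive fv :: "nat \<Rightarrow> trm \<Rightarrow> bool" where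
  "fv i (Var i)"
| "fv i M \<Longrightarrow> fv i (App M N)"
| "fv i N \<Longrightarrow> fv i (App M N)"
| "fv (Suc i) M \<Longrightarrow> fv i (Lam M)"
| "fv (Suc i) M \<Longrightarrow> fv i (LamI M)"
| "fv (Suc i) M \<Longrightarrow> fv i (LamC M)"
| "fv i M \<Longrightarrow> fv i (IBox M)"
| "fv i M \<Longrightarrow> fv i (CBox M)"

inductive occ0 :: "nat \<Rightarrow> trm \<Rightarrow> bool" where
  "occ0 i (Var i)"
| "occ0 i M \<Longrightarrow> occ0 i (App M N)"
| "occ0 i N \<Longrightarrow> occ0 i (App M N)"
| "occ0 (Suc i) M \<Longrightarrow> occ0 i (Lam M)"
| "occ0 (Suc i) M \<Longrightarrow> occ0 i (LamI M)"
| "occ0 (Suc i) M \<Longrightarrow> occ0 i (LamC M)"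
| "occ0 i M \<Longrightarrow> occ0 i (IBox M)"

inductive occ1 :: "nat \<Rightarrow> trm \<Rightarrow> bool" where
  "occ1 i M \<Longrightarrow> occ1 i (App M N)"
| "occ1 i N \<Longrightarrow> occ1 i (App M N)"
| "occ1 (Suc i) M \<Longrightarrow> occ1 i (Lam M)"
| "occ1 (Suc i) M \<Longrightarrow> occ1 i (LamI M)"
| "occ1 (Suc i) M \<Longrightarrow> occ1 i (LamC M)"
| "occ1 i M \<Longrightarrow> occ1 i (IBox M)"
| "fv i M \<Longrightarrow> occ1 i (CBox M)"

lemma esplit_parts:
  assumes "esplit \<Gamma> \<Gamma>1 \<Gamma>2"
  shows "\<Gamma>1 i \<noteq> None \<Longrightarrow> \<Gamma> i = \<Gamma>1 i" and "\<Gamma>2 i \<noteq> None \<Longrightarrow> \<Gamma> i = \<Gamma>2 i"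
  using assms[unfolded esplit_iff, THEN spec[of _ i]] by (auto elim: osplitE)

lemma fv_typed: "fv i M \<Longrightarrow> typed \<Gamma> M \<Longrightarrow> \<Gamma> i \<noteq> None"
proof (induction arbitrary: \<Gamma> rule: fv.induct)
  case (1 i)
  then show ?case by (auto elim!: typed_VarE)
next
  case (2 i M N)
  then show ?case by (metis typed_AppE esplit_parts(1))
next
  case (3 i N M)
  then show ?case by (metis typed_AppE esplit_parts(2))
next
  case (4 i M)
  then show ?case by (metis typed_LamE econs_simps(2))
next
  case (5 i M)
  then show ?case by (metis typed_LamIE econs_simps(2))
next
  case (6 i M)
  then show ?case by (metis typed_LamCE econs_simps(2))
next
  case (7 i M)
  from 7(3) have "mi_env \<Gamma> i \<noteq> None" by (rule typed_IBoxE) (rule 7(2))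
  then show ?case by (cases "\<Gamma> i") (auto simp: mi_env_def)
next
  case (8 i M)
  from 8(3) have "mc_env \<Gamma> i \<noteq> None" by (rule typed_CBoxE) (rule 8(2))
  then show ?case by (cases "\<Gamma> i") (auto simp: mc_env_def)
qed

text \<open>Splitting, binders and inductive boxes leave PC as it is, and the variable rule does not
  accept it.\<close>

lemma occ0_typed: "occ0 i M \<Longrightarrow> typed \<Gamma> M \<Longrightarrow> \<Gamma> i \<noteq> None \<and> \<Gamma> i \<noteq> Some PC"
proof (induction arbitrary: \<Gamma> rule: occ0.induct)
  case (1 i)
  then show ?case by (auto elim!: typed_VarE)
next
  case (2 i M N)
  then show ?case by (metis typed_AppE esplit_parts(1))
next
  case (3 i N M)
  then show ?case by (metis typed_AppE esplit_parts(2))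
next
  case (4 i M)
  then show ?case by (metis typed_LamE econs_simps(2))
next
  case (5 i M)
  then show ?case by (metis typed_LamIE econs_simps(2))
next
  case (6 i M)
  then show ?case by (metis typed_LamCE econs_simps(2))
next
  case (7 i M)
  from 7(3) have "mi_env \<Gamma> i \<noteq> None \<and> mi_env \<Gamma> i \<noteq> Some PC" by (rule typed_IBoxE) (rule 7(2))
  then show ?case by (cases "\<Gamma> i") (auto simp: mi_env_def)
qed

text \<open>The rule for \<open>CBox\<close> excludes PL and PI, and \<open>mc_env\<close> erases
  PH.\<close>

lemma occ1_typed: "occ1 i M \<Longrightarrow> typed \<Gamma> M \<Longrightarrow> \<Gamma> i = Some PC \<or> \<Gamma> i = Some PD"
proof (induction arbitrary: \<Gamma> rule: occ1.induct)
  case (1 i M N)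
  then show ?case by (metis typed_AppE esplit_parts(1) option.distinct(1))
next
  case (2 i N M)
  then show ?case by (metis typed_AppE esplit_parts(2) option.distinct(1))
next
  case (3 i M)
  then show ?case by (metis typed_LamE econs_simps(2))
next
  case (4 i M)
  then show ?case by (metis typed_LamIE econs_simps(2))
next
  case (5 i M)
  then show ?case by (metis typed_LamCE econs_simps(2))
next
  case (6 i M)
  from 6(3) have "mi_env \<Gamma> i = Some PC \<or> mi_env \<Gamma> i = Some PD" by (rule typed_IBoxE) (rule 6(2))
  then show ?case by (simp add: mi_env_eq_Some_iff)
next
  case (7 i M)
  from 7(2) have "mc_env \<Gamma> i \<noteq> None" by (rule typed_CBoxE) (rule fv_typed[OF 7(1)])
  then show ?case by (auto simp: mc_env_eq_Some_iff)
qed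

lemma occ0_LamC: "well_typed (LamC M) \<Longrightarrow> \<not> occ0 0 M"
  unfolding well_typed_def by (metis typed_LamCE econs_simps(1) occ0_typed)

lemma occ1_Lam: "well_typed (Lam M) \<Longrightarrow> \<not> occ1 0 M"
  unfolding well_typed_def by (metis typed_LamE econs_simps(1) occ1_typed option.inject pk.distinct)

lemma occ1_LamI: "well_typed (LamI M) \<Longrightarrow> \<not> occ1 0 M"
  unfolding well_typed_def by (metis typed_LamIE econs_simps(1) occ1_typed option.inject pk.distinct)

section \<open>Confluence of surface reduction\<close>

text \<open>Needed for the contents of coinductive boxes, which \<open>par\<close> leaves untouched:
  there two substitutions have to give equal results.\<close>

lemma subst_cong_fv:
  assumes "\<And>i. fv i M \<Longrightarrow> \<sigma> i = \<tau> i" shows "subst \<sigma> M = subst \<tau> M"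
proof -
  have ups: "\<forall>i. fv i M \<longrightarrow> ups \<sigma> i = ups \<tau> i" if "\<forall>i. fv (Suc i) M \<longrightarrow> \<sigma> i = \<tau> i" for M \<sigma> \<tau>
  proof (intro allI impI)
    fix i
    assume "fv i M"
    with that show "ups \<sigma> i = ups \<tau> i" by (cases i) simp_all
  qed
  have "\<forall>i. fv i M \<longrightarrow> \<sigma> i = \<tau> i" using assms by blast
  then show ?thesis
  proof (coinduction arbitrary: \<sigma> \<tau> M rule: trm.coinduct_strong)
    case Eq_trm
    show ?case
    proof (cases M)
      case (Var i)
      then have "\<sigma> i = \<tau> i" using Eq_trm fv.intros by blast
      then show ?thesis using Var by simp
    next
      case (App A B)
      then have "\<forall>i. fv i A \<longrightarrow> \<sigma> i = \<tau> i" "\<forall>i. fv i B \<longrightarrow> \<sigma> i = \<tau> i"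
        using Eq_trm by (auto intro: fv.intros)
      then show ?thesis using App by auto
    next
      case (Lam A)
      then have "\<forall>i. fv i A \<longrightarrow> ups \<sigma> i = ups \<tau> i" using Eq_trm by (intro ups) (auto intro: fv.intros)
      then show ?thesis using Lam by auto
    next
      case (LamI A)
      then have "\<forall>i. fv i A \<longrightarrow> ups \<sigma> i = ups \<tau> i" using Eq_trm by (intro ups) (auto intro: fv.intros)
      then show ?thesis using LamI by auto
    next
      case (LamC A)
      then have "\<forall>i. fv i A \<longrightarrow> ups \<sigma> i = ups \<tau> i" using Eq_trm by (intro ups) (auto intro: fv.intros)
      then show ?thesis using LamC by auto
    next
      case (IBox A)
      then have "\<forall>i. fv i A \<longrightarrow> \<sigma> i = \<tau> i" using Eq_trm by (auto intro: fv.intros)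
      then show ?thesis using IBox by auto
    next
      case (CBox A)
      then have "\<forall>i. fv i A \<longrightarrow> \<sigma> i = \<tau> i" using Eq_trm by (auto intro: fv.intros)
      then show ?thesis using CBox by auto
    qed
  qed
qed

text \<open>The box axiom and \<open>par_betaC\<close> freeze the contents of coinductive boxes, so
  that only surface redexes are contracted.\<close>

inductive par :: "trm \<Rightarrow> trm \<Rightarrow> bool" where
  par_Var: "par (Var i) (Var i)"
| par_App: "par M M' \<Longrightarrow> par N N' \<Longrightarrow> par (App M N) (App M' N')"
| par_Lam: "par M M' \<Longrightarrow> par (Lam M) (Lam M')"
| par_LamI: "par M M' \<Longrightarrow> par (LamI M) (LamI M')"
| par_LamC: "par M M' \<Longrightarrow> par (LamC M) (LamC M')"
| par_IBox: "par M M' \<Longrightarrow> par (IBox M) (IBox M')"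
| par_CBox: "par (CBox M) (CBox M)"
| par_beta: "par M M' \<Longrightarrow> par N N' \<Longrightarrow> par (App (Lam M) N) (inst M' N')"
| par_betaI: "par M M' \<Longrightarrow> par N N' \<Longrightarrow> par (App (LamI M) (IBox N)) (inst M' N')"
| par_betaC: "par M M' \<Longrightarrow> par (App (LamC M) (CBox N)) (inst M' N)"

inductive_cases par_VarE: "par (Var i) P"
inductive_cases par_AppE: "par (App M N) P"
inductive_cases par_LamE: "par (Lam M) P"
inductive_cases par_LamIE: "par (LamI M) P"
inductive_cases par_LamCE: "par (LamC M) P"
inductive_cases par_IBoxE: "par (IBox M) P"
inductive_cases par_CBoxE: "par (CBox M) P"

lemma rtranclp_cong1:
  assumes "\<And>x y. r x y \<Longrightarrow> s (f x) (f y)" and "r\<^sup>*\<^sup>* x y"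
  shows "s\<^sup>*\<^sup>* (f x) (f y)"
  using assms(2)
  by (induction rule: rtranclp_induct) (auto intro: rtranclp.rtrancl_into_rtrancl assms(1))

lemma step0s_App: "step0\<^sup>*\<^sup>* M M' \<Longrightarrow> step0\<^sup>*\<^sup>* N N' \<Longrightarrow> step0\<^sup>*\<^sup>* (App M N) (App M' N')"
  by (rule rtranclp_trans[of _ _ "App M' N"];
      rule rtranclp_cong1[of step0 step0 "\<lambda>M. App M N"] rtranclp_cong1[of step0 step0 "App M'"];
      simp add: step0.intros)

lemma step0s_cong:
  assumes "step0\<^sup>*\<^sup>* M M'"
  shows "step0\<^sup>*\<^sup>* (Lam M) (Lam M')" and "step0\<^sup>*\<^sup>* (LamI M) (LamI M')"
    and "step0\<^sup>*\<^sup>* (LamC M) (LamC M')" and "step0\<^sup>*\<^sup>* (IBox M) (IBox M')"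
  by (rule rtranclp_cong1[OF _ assms], erule step0.intros)+

lemma par_imp_step0s: "par M N \<Longrightarrow> step0\<^sup>*\<^sup>* M N"
proof (induction rule: par.induct)
  case (par_beta M M' N N')
  then have "step0\<^sup>*\<^sup>* (App (Lam M) N) (App (Lam M') N')" by (intro step0s_App step0s_cong)
  also have "step0 \<dots> (inst M' N')" by (intro step0_beta beta.intros)
  finally show ?case .
next
  case (par_betaI M M' N N')
  then have "step0\<^sup>*\<^sup>* (App (LamI M) (IBox N)) (App (LamI M') (IBox N'))"
    by (intro step0s_App step0s_cong)
  also have "step0 \<dots> (inst M' N')" by (intro step0_beta beta.intros)
  finally show ?case .
next
  case (par_betaC M M' N)
  then have "step0\<^sup>*\<^sup>* (App (LamC M) (CBox N)) (App (LamC M') (CBox N))"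
    by (intro step0s_App step0s_cong) simp_all
  also have "step0 \<dots> (inst M' N)" by (intro step0_beta beta.intros)
  finally show ?case .
qed (simp_all add: step0s_App step0s_cong)

lemma well_typed_par: "well_typed M \<Longrightarrow> par M N \<Longrightarrow> well_typed N"
  using well_typed_step0s par_imp_step0s by blast

text \<open>The inductive block of a typing derivation ends at coinductive boxes, where
  \<open>par\<close> has an axiom; induction on this block replaces the missing induction on
  terms.\<close>

lemma par_refl: "well_typed M \<Longrightarrow> par M M"
proof -
  have "par M M" if "typ_step typed \<Gamma> M" for \<Gamma>
    using that by (induction rule: typ_step.induct) (auto intro: par.intros)
  then show "well_typed M \<Longrightarrow> par M M" using typed_iff by (auto simp: well_typed_def)
qed

lemma step0_imp_par: "step0 M N \<Longrightarrow> well_typed M \<Longrightarrow> par M N"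
proof (induction rule: step0.induct)
  case (step0_beta M N)
  then show ?case
    by cases (auto intro!: par.intros par_refl dest: well_typed_sub)
qed (blast intro: par.intros par_refl dest: well_typed_sub)+

lemma par_ren: "par M N \<Longrightarrow> par (ren f M) (ren f N)"
  by (induction arbitrary: f rule: par.induct) (auto simp: ren_inst intro: par.intros)

lemma par_ups:
  "(\<And>i. occ0 (Suc i) M \<Longrightarrow> par (\<sigma> i) (\<tau> i)) \<Longrightarrow> occ0 i M \<Longrightarrow> par (ups \<sigma> i) (ups \<tau> i)"
  by (cases i) (auto intro: par_ren par_Var)

lemma eq_ups: "(\<And>i. occ1 (Suc i) M \<Longrightarrow> \<sigma> i = \<tau> i) \<Longrightarrow> occ1 i M \<Longrightarrow> ups \<sigma> i = ups \<tau> i"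
  by (cases i) auto

text \<open>Reducing the substituted terms is harmless at surface occurrences, but a copy inside a
  frozen box cannot follow; there the two substitutions must agree.\<close>

lemma par_subst:
  "par M M' \<Longrightarrow> (\<And>i. occ0 i M \<Longrightarrow> par (\<sigma> i) (\<tau> i)) \<Longrightarrow> (\<And>i. occ1 i M \<Longrightarrow> \<sigma> i = \<tau> i) \<Longrightarrow>
    par (subst \<sigma> M) (subst \<tau> M')"
proof (induction arbitrary: \<sigma> \<tau> rule: par.induct)
  case (par_Var i)
  then show ?case by (simp add: occ0.intros)
next
  case (par_App M M' N N')
  then show ?case by (auto intro!: par.intros simp: occ0.intros occ1.intros)
next
  case (par_Lam M M')
  have "par (subst (ups \<sigma>) M) (subst (ups \<tau>) M')"
    using par_Lam.prems by (intro par_Lam.IH par_ups eq_ups) (auto intro: occ0.intros occ1.intros)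
  then show ?case by (simp add: par.intros)
next
  case (par_LamI M M')
  have "par (subst (ups \<sigma>) M) (subst (ups \<tau>) M')"
    using par_LamI.prems by (intro par_LamI.IH par_ups eq_ups) (auto intro: occ0.intros occ1.intros)
  then show ?case by (simp add: par.intros)
next
  case (par_LamC M M')
  have "par (subst (ups \<sigma>) M) (subst (ups \<tau>) M')"
    using par_LamC.prems by (intro par_LamC.IH par_ups eq_ups) (auto intro: occ0.intros occ1.intros)
  then show ?case by (simp add: par.intros)
next
  case (par_IBox M M')
  then show ?case by (auto intro!: par.intros simp: occ0.intros occ1.intros)
next
  case (par_CBox M)
  then have "subst \<sigma> M = subst \<tau> M" by (intro subst_cong_fv) (auto intro: occ1.intros)
  then show ?case by (simp add: par.intros)
next
  case (par_beta M M' N N')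
  have "par (subst (ups \<sigma>) M) (subst (ups \<tau>) M')"
    using par_beta.prems by (intro par_beta.IH(1) par_ups eq_ups) (auto intro: occ0.intros occ1.intros)
  moreover have "par (subst \<sigma> N) (subst \<tau> N')"
    using par_beta.prems by (intro par_beta.IH(2)) (auto intro: occ0.intros occ1.intros)
  ultimately show ?case by (simp add: par.intros subst_inst)
next
  case (par_betaI M M' N N')
  have "par (subst (ups \<sigma>) M) (subst (ups \<tau>) M')"
    using par_betaI.prems by (intro par_betaI.IH(1) par_ups eq_ups) (auto intro: occ0.intros occ1.intros)
  moreover have "par (subst \<sigma> N) (subst \<tau> N')"
    using par_betaI.prems by (intro par_betaI.IH(2)) (auto intro: occ0.intros occ1.intros)
  ultimately show ?case by (simp add: par.intros subst_inst)
next
  case (par_betaC M M' N)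
  have "par (subst (ups \<sigma>) M) (subst (ups \<tau>) M')"
    using par_betaC.prems by (intro par_betaC.IH(1) par_ups eq_ups) (auto intro: occ0.intros occ1.intros)
  moreover have "subst \<sigma> N = subst \<tau> N"
    using par_betaC.prems by (intro subst_cong_fv) (auto intro: occ1.intros)
  ultimately show ?case by (simp add: par.intros subst_inst)
qed

text \<open>For \<open>Lam\<close> and \<open>LamI\<close> typing makes the condition on
  \<open>occ1\<close> vacuous. For \<open>LamC\<close> it makes the one on \<open>occ0\<close>
  vacuous, and the argument, coming from a frozen box, is the same on both sides.\<close>

lemma par_inst:
  assumes "par M M'" and "occ0 0 M \<Longrightarrow> par N N'" and "occ1 0 M \<Longrightarrow> N = N'"
  shows "par (inst M N) (inst M' N')"
  unfolding inst_def
proof (rule par_subst[OF assms(1)])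
  show "par (sub1 N i) (sub1 N' i)" if "occ0 i M" for i
    by (cases i) (use that assms(2) in \<open>simp_all add: par_Var\<close>)
  show "sub1 N i = sub1 N' i" if "occ1 i M" for i
    by (cases i) (use that assms(3) in simp_all)
qed

lemma par_diamond:
  "par M M1 \<Longrightarrow> par M M2 \<Longrightarrow> well_typed M \<Longrightarrow> \<exists>P. par M1 P \<and> par M2 P"
proof (induction arbitrary: M2 rule: par.induct)
  case (par_Var i)
  then show ?case by (auto elim!: par_VarE intro: par.intros)
next
  case (par_App M M' N N')
  have wt: "well_typed M" "well_typed N" using par_App.prems(2) by (auto dest: well_typed_sub)
  have N: "\<exists>P. par N' P \<and> par N2 P" if "par N N2" for N2 using par_App.IH(2)[OF that wt(2)] .
  have M: "\<exists>P. par M' P \<and> par M2 P" if "par M M2" for M2 using par_App.IH(1)[OF that wt(1)] .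
  from par_App.prems(1)
  consider (1) A B where "M2 = App A B" "par M A" "par N B"
    | (2) A A2 B2 where "M2 = inst A2 B2" "M = Lam A" "par A A2" "par N B2"
    | (3) A A2 B B2 where "M2 = inst A2 B2" "M = LamI A" "N = IBox B" "par A A2" "par B B2"
    | (4) A A2 B where "M2 = inst A2 B" "M = LamC A" "N = CBox B" "par A A2"
    by (rule par_AppE) blast+
  then show ?case
  proof cases
    case 1
    with M N obtain P Q where "par M' P" "par A P" "par N' Q" "par B Q" by blast
    then show ?thesis using 1 by (blast intro: par.intros)
  next
    case 2
    \<comment> \<open>The induction hypothesis concerns the whole function \<open>Lam A\<close>, so
      the reduct of its body is wrapped again before the two sides are joined.\<close>
    from M[of "Lam A2"] 2 obtain P where P: "par M' P" "par (Lam A2) P" by (blast intro: par.intros)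
    from par_App.hyps(1) 2 obtain A1 where A1: "M' = Lam A1" by (auto elim: par_LamE)
    from P A1 obtain A3 where A3: "par A1 A3" "par A2 A3" by (auto elim!: par_LamE)
    from N 2 obtain B3 where B3: "par N' B3" "par B2 B3" by blast
    \<comment> \<open>The contracted side has already copied \<open>B2\<close>; every copy must
      still be able to reduce to \<open>B3\<close>.\<close>
    have "\<not> occ1 0 A2"
      using wt(1) 2 well_typed_par[of "Lam A" "Lam A2"] by (intro occ1_Lam) (auto intro: par.intros)
    then have "par (inst A2 B2) (inst A3 B3)" using A3 B3 by (intro par_inst) auto
    moreover have "par (App M' N') (inst A3 B3)" using A1 A3 B3 by (auto intro: par.intros)
    ultimately show ?thesis using 2 by blast
  next
    case 3
    from M[of "LamI A2"] 3 obtain P where P: "par M' P" "par (LamI A2) P" by (blast intro: par.intros)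
    from par_App.hyps(1) 3 obtain A1 where A1: "M' = LamI A1" by (auto elim: par_LamIE)
    from P A1 obtain A3 where A3: "par A1 A3" "par A2 A3" by (auto elim!: par_LamIE)
    from N[of "IBox B2"] 3 obtain Q where Q: "par N' Q" "par (IBox B2) Q" by (blast intro: par.intros)
    from par_App.hyps(2) 3 obtain B1 where B1: "N' = IBox B1" by (auto elim: par_IBoxE)
    from Q B1 obtain B3 where B3: "par B1 B3" "par B2 B3" by (auto elim!: par_IBoxE)
    have "\<not> occ1 0 A2"
      using wt(1) 3 well_typed_par[of "LamI A" "LamI A2"] by (intro occ1_LamI) (auto intro: par.intros)
    then have "par (inst A2 B2) (inst A3 B3)" using A3 B3 by (intro par_inst) auto
    moreover have "par (App M' N') (inst A3 B3)" using A1 B1 A3 B3 by (auto intro: par.intros)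
    ultimately show ?thesis using 3 by blast
  next
    case 4
    from M[of "LamC A2"] 4 obtain P where P: "par M' P" "par (LamC A2) P" by (blast intro: par.intros)
    from par_App.hyps(1) 4 obtain A1 where A1: "M' = LamC A1" by (auto elim: par_LamCE)
    from P A1 obtain A3 where A3: "par A1 A3" "par A2 A3" by (auto elim!: par_LamCE)
    from par_App.hyps(2) 4 have B1: "N' = CBox B" by (auto elim: par_CBoxE)
    have "\<not> occ0 0 A2"
      using wt(1) 4 well_typed_par[of "LamC A" "LamC A2"] by (intro occ0_LamC) (auto intro: par.intros)
    then have "par (inst A2 B) (inst A3 B)" using A3 by (intro par_inst) auto
    moreover have "par (App M' N') (inst A3 B)" using A1 B1 A3 by (auto intro: par.intros)
    ultimately show ?thesis using 4 by blast
  qed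
next
  case (par_Lam M M')
  from par_Lam.prems(1) obtain M3 where "M2 = Lam M3" "par M M3" by (rule par_LamE)
  with par_Lam.IH par_Lam.prems(2) show ?case by (blast intro: par.intros dest: well_typed_sub)
next
  case (par_LamI M M')
  from par_LamI.prems(1) obtain M3 where "M2 = LamI M3" "par M M3" by (rule par_LamIE)
  with par_LamI.IH par_LamI.prems(2) show ?case by (blast intro: par.intros dest: well_typed_sub)
next
  case (par_LamC M M')
  from par_LamC.prems(1) obtain M3 where "M2 = LamC M3" "par M M3" by (rule par_LamCE)
  with par_LamC.IH par_LamC.prems(2) show ?case by (blast intro: par.intros dest: well_typed_sub)
next
  case (par_IBox M M')
  from par_IBox.prems(1) obtain M3 where "M2 = IBox M3" "par M M3" by (rule par_IBoxE)
  with par_IBox.IH par_IBox.prems(2) show ?case by (blast intro: par.intros dest: well_typed_sub)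
next
  case (par_CBox M)
  then show ?case by (auto elim!: par_CBoxE intro: par.intros)
next
  case (par_beta A A1 B B1)
  have wt: "well_typed (Lam A)" "well_typed A" "well_typed B"
    using par_beta.prems(2) by (auto dest: well_typed_sub)
  have nocc: "\<not> occ1 0 A'" if "par A A'" for A'
    by (rule occ1_Lam[OF well_typed_par[OF wt(1) par.par_Lam[OF that]]])
  from par_beta.prems(1) obtain A2 B2 where *: "par A A2" "par B B2"
    and M2: "M2 = App (Lam A2) B2 \<or> M2 = inst A2 B2"
    by (auto elim!: par_AppE par_LamE)
  from par_beta.IH * wt obtain A3 B3
    where J: "par A1 A3" "par A2 A3" "par B1 B3" "par B2 B3" by blast
  have "par (inst A1 B1) (inst A3 B3)" "par (inst A2 B2) (inst A3 B3)"
    using J nocc[OF par_beta.hyps(1)] nocc[OF *(1)] by (auto intro: par_inst)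
  moreover have "par (App (Lam A2) B2) (inst A3 B3)" using J by (intro par.intros)
  ultimately show ?case using M2 by blast
next
  case (par_betaI A A1 B B1)
  have wt: "well_typed (LamI A)" "well_typed A" "well_typed B"
    using par_betaI.prems(2) by (auto dest: well_typed_sub)
  have nocc: "\<not> occ1 0 A'" if "par A A'" for A'
    by (rule occ1_LamI[OF well_typed_par[OF wt(1) par.par_LamI[OF that]]])
  from par_betaI.prems(1) obtain A2 B2 where *: "par A A2" "par B B2"
    and M2: "M2 = App (LamI A2) (IBox B2) \<or> M2 = inst A2 B2"
    by (auto elim!: par_AppE par_LamIE par_IBoxE)
  from par_betaI.IH * wt obtain A3 B3
    where J: "par A1 A3" "par A2 A3" "par B1 B3" "par B2 B3" by blast
  have "par (inst A1 B1) (inst A3 B3)" "par (inst A2 B2) (inst A3 B3)"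
    using J nocc[OF par_betaI.hyps(1)] nocc[OF *(1)] by (auto intro: par_inst)
  moreover have "par (App (LamI A2) (IBox B2)) (inst A3 B3)" using J by (intro par.intros)
  ultimately show ?case using M2 by blast
next
  case (par_betaC A A1 B)
  have wt: "well_typed (LamC A)" "well_typed A"
    using par_betaC.prems(2) by (auto dest: well_typed_sub)
  have nocc: "\<not> occ0 0 A'" if "par A A'" for A'
    by (rule occ0_LamC[OF well_typed_par[OF wt(1) par.par_LamC[OF that]]])
  from par_betaC.prems(1) obtain A2 where *: "par A A2"
    and M2: "M2 = App (LamC A2) (CBox B) \<or> M2 = inst A2 B"
    by (auto elim!: par_AppE par_LamCE par_CBoxE)
  from par_betaC.IH * wt obtain A3 where J: "par A1 A3" "par A2 A3" by blast
  have "par (inst A1 B) (inst A3 B)" "par (inst A2 B) (inst A3 B)"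
    using J nocc[OF par_betaC.hyps(1)] nocc[OF *] by (auto intro: par_inst)
  moreover have "par (App (LamC A2) (CBox B)) (inst A3 B)" using J by (intro par.intros)
  ultimately show ?case using M2 by blast
qed

lemma step0_confluent:
  assumes "well_typed M" and "step0\<^sup>*\<^sup>* M N" and "step0\<^sup>*\<^sup>* M L"
  shows "\<exists>P. step0\<^sup>*\<^sup>* N P \<and> step0\<^sup>*\<^sup>* L P"
proof -
  \<comment> \<open>The confluence criterion quantifies over all terms, whereas the diamond property
    holds for typable ones; typability is therefore part of the relation.\<close>
  let ?r = "\<lambda>M N. well_typed M \<and> par M N"
  have "strong_confluentp ?r"
  proof
    fix M N L
    assume *: "?r M N" "?r M L"
    then obtain P where "par N P" "par L P" using par_diamond by blast
    then have "?r\<^sup>*\<^sup>* N P" "?r L P" using * well_typed_par by auto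
    then show "\<exists>P. ?r\<^sup>*\<^sup>* N P \<and> ?r\<^sup>=\<^sup>= L P" by blast
  qed
  then have confl: "confluentp ?r" by (rule strong_confluentp_imp_confluentp)
  have to: "?r\<^sup>*\<^sup>* M N" if "step0\<^sup>*\<^sup>* M N" for N
    using that
  proof (induction rule: rtranclp_induct)
    case (step N P)
    have "well_typed N" using assms(1) step.hyps(1) by (rule well_typed_step0s)
    then have "?r N P" using step.hyps(2) step0_imp_par by blast
    with step.IH show ?case by (rule rtranclp.rtrancl_into_rtrancl)
  qed simp
  have from_r: "step0\<^sup>*\<^sup>* N P" if "?r\<^sup>*\<^sup>* N P" for N P
    using that
    by (induction rule: rtranclp_induct) (auto dest: par_imp_step0s)
  from confluentpD[OF confl to[OF assms(2)] to[OF assms(3)]] show ?thesis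
    using from_r by blast
qed

section \<open>Infinitary reduction by surface steps\<close>

coinductive infred0 :: "trm \<Rightarrow> trm \<Rightarrow> bool" where
  "step0\<^sup>*\<^sup>* M N \<Longrightarrow> lstep infred0 N L \<Longrightarrow> infred0 M L"

lemma infred0_coinduct:
  assumes "X M N"
    and "\<And>M N. X M N \<Longrightarrow> \<exists>K. step0\<^sup>*\<^sup>* M K \<and> lstep (\<lambda>M N. X M N \<or> infred0 M N) K N"
  shows "infred0 M N"
  using assms(1) by (rule infred0.coinduct) (use assms(2) in blast)

lemma lstep_imp_infred0: "lstep infred0 M N \<Longrightarrow> infred0 M N"
  by (rule infred0.intros) simp_all

lemma lstep_monoD: "lstep X M N \<Longrightarrow> (\<And>M N. X M N \<Longrightarrow> Y M N) \<Longrightarrow> lstep Y M N"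
  using lstep_mono by blast

inductive_cases lstep_VarE: "lstep X (Var i) Q"
inductive_cases lstep_AppE: "lstep X (App M N) Q"
inductive_cases lstep_LamE: "lstep X (Lam M) Q"
inductive_cases lstep_LamIE: "lstep X (LamI M) Q"
inductive_cases lstep_LamCE: "lstep X (LamC M) Q"
inductive_cases lstep_IBoxE: "lstep X (IBox M) Q"
inductive_cases lstep_CBoxE: "lstep X (CBox M) Q"
lemmas lstep_leftE = lstep_VarE lstep_AppE lstep_LamE lstep_LamIE lstep_LamCE lstep_IBoxE lstep_CBoxE

inductive_cases lstep_AppE': "lstep X Q (App M N)"
inductive_cases lstep_LamE': "lstep X Q (Lam M)"
inductive_cases lstep_LamIE': "lstep X Q (LamI M)"
inductive_cases lstep_LamCE': "lstep X Q (LamC M)"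
inductive_cases lstep_IBoxE': "lstep X Q (IBox M)"
inductive_cases lstep_CBoxE': "lstep X Q (CBox M)"
lemmas lstep_rightE = lstep_AppE' lstep_LamE' lstep_LamIE' lstep_LamCE' lstep_IBoxE' lstep_CBoxE'

lemma beta_ren: "beta M N \<Longrightarrow> beta (ren f M) (ren f N)"
  by (induction rule: beta.induct) (simp_all add: ren_inst beta.intros)

lemma step0_ren: "step0 M N \<Longrightarrow> step0 (ren f M) (ren f N)"
  by (induction arbitrary: f rule: step0.induct) (auto intro: step0.intros beta_ren)

lemma beta_subst: "beta M N \<Longrightarrow> beta (subst \<sigma> M) (subst \<sigma> N)"
  by (induction rule: beta.induct) (simp_all add: subst_inst beta.intros)

lemma step0_subst: "step0 M N \<Longrightarrow> step0 (subst \<sigma> M) (subst \<sigma> N)"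
  by (induction arbitrary: \<sigma> rule: step0.induct) (auto intro: step0.intros beta_subst)

lemma lstep_ren:
  "lstep X M N \<Longrightarrow> (\<And>M N f. X M N \<Longrightarrow> Y (ren f M) (ren f N)) \<Longrightarrow> lstep Y (ren f M) (ren f N)"
  by (induction arbitrary: f rule: lstep.induct) (auto intro: lstep.intros)

lemma infred0_ren:
  assumes "infred0 M N" shows "infred0 (ren f M) (ren f N)"
proof (rule infred0_coinduct)
  let ?X = "\<lambda>A B. \<exists>M N f. infred0 M N \<and> A = ren f M \<and> B = ren f N"
  show "?X (ren f M) (ren f N)" using assms by blast
  fix A B
  assume "?X A B"
  then obtain M N f where "infred0 M N" and AB: "A = ren f M" "B = ren f N" by blast
  then obtain K where K: "step0\<^sup>*\<^sup>* M K" "lstep infred0 K N" by (auto elim: infred0.cases)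
  have "step0\<^sup>*\<^sup>* A (ren f K)"
    unfolding AB using step0_ren K(1) by (rule rtranclp_cong1)
  moreover have "lstep (\<lambda>A B. ?X A B \<or> infred0 A B) (ren f K) B"
    unfolding AB using K(2) by (rule lstep_ren) blast
  ultimately show "\<exists>K. step0\<^sup>*\<^sup>* A K \<and> lstep (\<lambda>A B. ?X A B \<or> infred0 A B) K B" by blast
qed

lemma lstep_infred0_ren: "lstep infred0 M N \<Longrightarrow> lstep infred0 (ren f M) (ren f N)"
  by (rule lstep_ren[of infred0]) (auto intro: infred0_ren)

lemma infred0_Var: "infred0 (Var i) (Var i)"
  by (auto intro: lstep_imp_infred0 lstep.intros)

lemma infred0_ups: "(\<And>i. infred0 (\<sigma> i) (\<tau> i)) \<Longrightarrow> infred0 (ups \<sigma> i) (ups \<tau> i)"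
  by (cases i) (simp_all add: infred0_Var infred0_ren)

text \<open>A term substituted at the surface may need surface steps of its own before its limit
  layer starts, hence the intermediate \<open>K\<close>. The parameter \<open>X\<close> leaves room
  for the coinduction invariant of \<open>infred0_subst\<close>.\<close>

lemma lstep_subst_aux:
  assumes "lstep infred0 M N" and "\<And>i. infred0 (\<sigma> i) (\<tau> i)"
    and "\<And>M N. infred0 M N \<Longrightarrow> X M N"
    and "\<And>M N \<sigma> \<tau>. infred0 M N \<Longrightarrow> (\<And>i. infred0 (\<sigma> i) (\<tau> i)) \<Longrightarrow> X (subst \<sigma> M) (subst \<tau> N)"
  shows "\<exists>K. step0\<^sup>*\<^sup>* (subst \<sigma> M) K \<and> lstep X K (subst \<tau> N)"
  using assms(1,2)
proof (induction arbitrary: \<sigma> \<tau> rule: lstep.induct)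
  case (1 i)
  then have "infred0 (\<sigma> i) (\<tau> i)" by simp
  then obtain K where "step0\<^sup>*\<^sup>* (\<sigma> i) K" "lstep infred0 K (\<tau> i)" by (auto elim: infred0.cases)
  then show ?case using lstep_monoD[OF _ assms(3)] by auto
next
  case (2 M N L P)
  from "2.IH"[of \<sigma> \<tau>] "2.prems" obtain K K'
    where "step0\<^sup>*\<^sup>* (subst \<sigma> M) K" "lstep X K (subst \<tau> N)"
      "step0\<^sup>*\<^sup>* (subst \<sigma> L) K'" "lstep X K' (subst \<tau> P)" by blast
  then show ?case by (auto intro!: exI[of _ "App K K'"] step0s_App lstep.intros)
next
  case (3 M N)
  from "3.IH"[of "ups \<sigma>" "ups \<tau>"] "3.prems" obtain K
    where "step0\<^sup>*\<^sup>* (subst (ups \<sigma>) M) K" "lstep X K (subst (ups \<tau>) N)"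
    by (blast intro: infred0_ups)
  then show ?case by (auto intro!: exI[of _ "Lam K"] step0s_cong lstep.intros)
next
  case (4 M N)
  from "4.IH"[of "ups \<sigma>" "ups \<tau>"] "4.prems" obtain K
    where "step0\<^sup>*\<^sup>* (subst (ups \<sigma>) M) K" "lstep X K (subst (ups \<tau>) N)"
    by (blast intro: infred0_ups)
  then show ?case by (auto intro!: exI[of _ "LamI K"] step0s_cong lstep.intros)
next
  case (5 M N)
  from "5.IH"[of "ups \<sigma>" "ups \<tau>"] "5.prems" obtain K
    where "step0\<^sup>*\<^sup>* (subst (ups \<sigma>) M) K" "lstep X K (subst (ups \<tau>) N)"
    by (blast intro: infred0_ups)
  then show ?case by (auto intro!: exI[of _ "LamC K"] step0s_cong lstep.intros)
next
  case (6 M N)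
  from "6.IH"[of \<sigma> \<tau>] "6.prems" obtain K
    where "step0\<^sup>*\<^sup>* (subst \<sigma> M) K" "lstep X K (subst \<tau> N)" by blast
  then show ?case by (auto intro!: exI[of _ "IBox K"] step0s_cong lstep.intros)
next
  case (7 M N)
  then have "X (subst \<sigma> M) (subst \<tau> N)" by (intro assms(4))
  then show ?case by (auto intro: lstep.intros)
qed

lemma infred0_subst:
  assumes "infred0 M N" and "\<And>i. infred0 (\<sigma> i) (\<tau> i)"
  shows "infred0 (subst \<sigma> M) (subst \<tau> N)"
proof (rule infred0_coinduct)
  let ?X = "\<lambda>A B. \<exists>M N \<sigma> \<tau>. infred0 M N \<and> (\<forall>i. infred0 (\<sigma> i) (\<tau> i)) \<and> A = subst \<sigma> M \<and> B = subst \<tau> N"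
  show "?X (subst \<sigma> M) (subst \<tau> N)" using assms by blast
  fix A B
  assume "?X A B"
  then obtain M N \<sigma> \<tau> where "infred0 M N" and \<sigma>: "\<And>i. infred0 (\<sigma> i) (\<tau> i)"
    and AB: "A = subst \<sigma> M" "B = subst \<tau> N" by blast
  then obtain K where K: "step0\<^sup>*\<^sup>* M K" "lstep infred0 K N" by (auto elim: infred0.cases)
  have "step0\<^sup>*\<^sup>* A (subst \<sigma> K)"
    unfolding AB using step0_subst K(1) by (rule rtranclp_cong1)
  moreover have "\<exists>K'. step0\<^sup>*\<^sup>* (subst \<sigma> K) K' \<and> lstep (\<lambda>A B. ?X A B \<or> infred0 A B) K' B"
    unfolding AB using K(2) \<sigma> by (rule lstep_subst_aux) blast+
  ultimately show "\<exists>K. step0\<^sup>*\<^sup>* A K \<and> lstep (\<lambda>A B. ?X A B \<or> infred0 A B) K B"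
    by (blast intro: rtranclp_trans)
qed

lemma lstep_ups:
  "(\<And>i. occ0 (Suc i) M \<Longrightarrow> lstep infred0 (\<sigma> i) (\<tau> i)) \<Longrightarrow> occ0 i M \<Longrightarrow> lstep infred0 (ups \<sigma> i) (ups \<tau> i)"
  by (cases i) (auto intro: lstep_infred0_ren lstep.intros)

text \<open>No preliminary surface steps are needed if the terms put at surface occurrences are
  already related by \<open>lstep\<close>. Elsewhere they land inside coinductive boxes, where
  \<open>infred0\<close> absorbs such steps.\<close>

lemma lstep_subst:
  "lstep infred0 M N \<Longrightarrow> (\<And>i. infred0 (\<sigma> i) (\<tau> i)) \<Longrightarrow>
    (\<And>i. occ0 i M \<Longrightarrow> lstep infred0 (\<sigma> i) (\<tau> i)) \<Longrightarrow> lstep infred0 (subst \<sigma> M) (subst \<tau> N)"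
proof (induction arbitrary: \<sigma> \<tau> rule: lstep.induct)
  case (1 i)
  then show ?case by (simp add: occ0.intros)
next
  case (2 M N L P)
  then show ?case by (auto intro!: lstep.intros simp: occ0.intros)
next
  case (3 M N)
  have "lstep infred0 (subst (ups \<sigma>) M) (subst (ups \<tau>) N)"
    using "3.prems" by (intro "3.IH" infred0_ups lstep_ups[of M]) (auto intro: occ0.intros)
  then show ?case by (auto intro: lstep.intros)
next
  case (4 M N)
  have "lstep infred0 (subst (ups \<sigma>) M) (subst (ups \<tau>) N)"
    using "4.prems" by (intro "4.IH" infred0_ups lstep_ups[of M]) (auto intro: occ0.intros)
  then show ?case by (auto intro: lstep.intros)
next
  case (5 M N)
  have "lstep infred0 (subst (ups \<sigma>) M) (subst (ups \<tau>) N)"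
    using "5.prems" by (intro "5.IH" infred0_ups lstep_ups[of M]) (auto intro: occ0.intros)
  then show ?case by (auto intro: lstep.intros)
next
  case (6 M N)
  then show ?case by (auto intro!: lstep.intros simp: occ0.intros)
next
  case (7 M N)
  then show ?case by (auto intro!: lstep.intros infred0_subst)
qed

lemma lstep_inst:
  assumes "lstep infred0 M M'" and "infred0 N N'" and "occ0 0 M \<Longrightarrow> lstep infred0 N N'"
  shows "lstep infred0 (inst M N) (inst M' N')"
  unfolding inst_def
proof (rule lstep_subst[OF assms(1)])
  show "infred0 (sub1 N i) (sub1 N' i)" for i
    by (cases i) (simp_all add: infred0_Var assms(2))
  show "lstep infred0 (sub1 N i) (sub1 N' i)" if "occ0 i M" for i
    by (cases i) (use that assms(3) in \<open>simp_all add: lstep.intros\<close>)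
qed

text \<open>Since a coinductive variable never occurs at the surface, passing to the limit below
  coinductive boxes neither creates nor destroys surface redexes and commutes with contracting
  them.\<close>

lemma lstep_beta:
  assumes "beta M Q" and "well_typed M" and "lstep infred0 M M'"
  shows "\<exists>Q'. beta M' Q' \<and> lstep infred0 Q Q'"
  using assms(1)
proof cases
  case (1 A B)
  from assms(3)[unfolded 1] obtain A' B' where M': "M' = App (Lam A') B'"
    and *: "lstep infred0 A A'" "lstep infred0 B B'"
    by (auto elim!: lstep_leftE)
  then have "lstep infred0 Q (inst A' B')"
    unfolding 1 by (intro lstep_inst lstep_imp_infred0)
  then show ?thesis unfolding M' by (blast intro: beta.intros)
next
  case (2 A B)
  from assms(3)[unfolded 2] obtain A' B' where M': "M' = App (LamI A') (IBox B')"
    and *: "lstep infred0 A A'" "lstep infred0 B B'"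
    by (auto elim!: lstep_leftE)
  then have "lstep infred0 Q (inst A' B')"
    unfolding 2 by (intro lstep_inst lstep_imp_infred0)
  then show ?thesis unfolding M' by (blast intro: beta.intros)
next
  case (3 A B)
  from assms(3)[unfolded 3] obtain A' B' where M': "M' = App (LamC A') (CBox B')"
    and *: "lstep infred0 A A'" "infred0 B B'"
    by (auto elim!: lstep_leftE)
  \<comment> \<open>Box contents are related only by \<open>infred0\<close>, which is too weak for a
    surface occurrence; typing rules such occurrences out.\<close>
  have "\<not> occ0 0 A" using assms(2)[unfolded 3] by (rule occ0_LamC[OF well_typed_sub(1)])
  with * have "lstep infred0 Q (inst A' B')"
    unfolding 3 by (intro lstep_inst) auto
  then show ?thesis unfolding M' by (blast intro: beta.intros)
qed

lemma beta_lstep: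
  assumes "beta M' Q'" and "well_typed M" and "lstep infred0 M M'"
  shows "\<exists>Q. beta M Q \<and> lstep infred0 Q Q'"
proof -
  have "\<exists>Q. beta M Q"
    using assms(1)
  proof cases
    case (1 A B)
    with assms(3) show ?thesis by (auto elim!: lstep_rightE intro: beta.intros)
  next
    case (2 A B)
    with assms(3) show ?thesis by (auto elim!: lstep_rightE intro: beta.intros)
  next
    case (3 A B)
    with assms(3) show ?thesis by (auto elim!: lstep_rightE intro: beta.intros)
  qed
  then obtain Q where "beta M Q" by blast
  moreover from lstep_beta[OF this assms(2,3)] obtain P where "beta M' P" "lstep infred0 Q P" by blast
  \<comment> \<open>A redex determines its contractum, so the forward simulation already yields the
    required term.\<close>
  moreover have "P = Q'" using \<open>beta M' P\<close> assms(1) by (auto elim!: beta.cases)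
  ultimately show ?thesis by blast
qed

lemma lstep_step0:
  "step0 M Q \<Longrightarrow> well_typed M \<Longrightarrow> lstep infred0 M M' \<Longrightarrow> \<exists>Q'. step0 M' Q' \<and> lstep infred0 Q Q'"
proof (induction arbitrary: M' rule: step0.induct)
  case (step0_beta M Q)
  from lstep_beta[OF step0_beta] show ?case by (blast intro: step0.intros)
qed (erule lstep_leftE; blast intro: step0.intros lstep.intros dest: well_typed_sub)+

lemma step0_lstep:
  "step0 M' Q' \<Longrightarrow> well_typed M \<Longrightarrow> lstep infred0 M M' \<Longrightarrow> \<exists>Q. step0 M Q \<and> lstep infred0 Q Q'"
proof (induction arbitrary: M rule: step0.induct)
  case (step0_beta M' Q')
  from beta_lstep[OF step0_beta] show ?case by (blast intro: step0.intros)
qed (erule lstep_rightE; blast intro: step0.intros lstep.intros dest: well_typed_sub)+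

lemma lstep_step0s:
  assumes "step0\<^sup>*\<^sup>* M Q" and "well_typed M" and "lstep infred0 M M'"
  shows "\<exists>Q'. step0\<^sup>*\<^sup>* M' Q' \<and> lstep infred0 Q Q'"
  using assms(1)
proof (induction rule: rtranclp_induct)
  case base
  then show ?case using assms(3) by blast
next
  case (step P Q)
  then obtain P' where "step0\<^sup>*\<^sup>* M' P'" "lstep infred0 P P'" by blast
  moreover have "well_typed P" using assms(2) step.hyps(1) by (rule well_typed_step0s)
  ultimately show ?case
    using lstep_step0[OF step.hyps(2)] by (blast intro: rtranclp.rtrancl_into_rtrancl)
qed

lemma step0s_lstep:
  assumes "step0\<^sup>*\<^sup>* M' Q'" and "well_typed M" and "lstep infred0 M M'"
  shows "\<exists>Q. step0\<^sup>*\<^sup>* M Q \<and> lstep infred0 Q Q'"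
  using assms(1)
proof (induction rule: rtranclp_induct)
  case base
  then show ?case using assms(3) by blast
next
  case (step P' Q')
  then obtain P where P: "step0\<^sup>*\<^sup>* M P" "lstep infred0 P P'" by blast
  moreover have "well_typed P" using assms(2) P(1) by (rule well_typed_step0s)
  ultimately show ?case
    using step0_lstep[OF step.hyps(2)] by (blast intro: rtranclp.rtrancl_into_rtrancl)
qed

text \<open>Stated for three relations so that it serves both \<open>infred0\<close> followed by
  itself and \<open>infred0\<close> followed by \<open>infred\<close>. Typability is passed on to
  the box contents, where the coinduction continues.\<close>

lemma lstep_trans:
  "lstep X M N \<Longrightarrow> lstep Y N L \<Longrightarrow> well_typed M \<Longrightarrow>
    (\<And>M N L. X M N \<Longrightarrow> Y N L \<Longrightarrow> well_typed M \<Longrightarrow> Z M L) \<Longrightarrow> lstep Z M L"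
proof (induction arbitrary: L rule: lstep.induct)
  case (2 M N L' P)
  from "2.prems"(1) show ?case
    by (rule lstep_AppE) (use "2.IH" "2.prems" in \<open>blast intro: lstep.intros dest: well_typed_sub\<close>)
qed (erule lstep_leftE; blast intro: lstep.intros dest: well_typed_sub)+

text \<open>The surface steps starting the second reduction are pulled back across the limit layer
  of the first. Then the two limit layers are adjacent and compose, leaving compositions inside
  boxes to coinduction. Typability of \<open>M\<close> passes along surface steps to every term that
  needs it.\<close>

lemma infred0_trans:
  assumes "infred0 M N" and "infred0 N L" and "well_typed M"
  shows "infred0 M L"
proof (rule infred0_coinduct)
  let ?X = "\<lambda>M L. \<exists>N. infred0 M N \<and> infred0 N L \<and> well_typed M"
  show "?X M L" using assms by blast
  fix M L
  assume "?X M L"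
  then obtain N where "infred0 M N" "infred0 N L" and M: "well_typed M" by blast
  then obtain A B where A: "step0\<^sup>*\<^sup>* M A" "lstep infred0 A N" and B: "step0\<^sup>*\<^sup>* N B" "lstep infred0 B L"
    by (auto elim!: infred0.cases)
  have "well_typed A" using M A(1) by (rule well_typed_step0s)
  then obtain C where C: "step0\<^sup>*\<^sup>* A C" "lstep infred0 C B" using step0s_lstep[OF B(1) _ A(2)] by blast
  have "well_typed C" using \<open>well_typed A\<close> C(1) by (rule well_typed_step0s)
  with C(2) B(2) have "lstep (\<lambda>M L. ?X M L \<or> infred0 M L) C L" by (rule lstep_trans) blast
  moreover have "step0\<^sup>*\<^sup>* M C" using A(1) C(1) by (rule rtranclp_trans)
  ultimately show "\<exists>K. step0\<^sup>*\<^sup>* M K \<and> lstep (\<lambda>M L. ?X M L \<or> infred0 M L) K L" by blast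
qed

section \<open>Surface steps suffice\<close>

lemma lstep_refl_right:
  "lstep X M N \<Longrightarrow> (\<And>M N. X M N \<Longrightarrow> Y N N) \<Longrightarrow> lstep Y N N"
  by (induction rule: lstep.induct) (auto intro: lstep.intros)

text \<open>Each layer of a limit is built by the inductive \<open>lstep\<close>, so its surface is
  finite at every depth. This regularity stands in for typability of limits, which is established
  only later.\<close>

lemma infred0_lstep_refl:
  assumes "infred0 M N" shows "lstep infred0 N N"
proof -
  have refl: "infred0 N N" if "infred0 M N" for M N
  proof (rule infred0_coinduct[of "\<lambda>N N'. N' = N \<and> (\<exists>M. infred0 M N)"])
    let ?X = "\<lambda>N N'. N' = N \<and> (\<exists>M. infred0 M N)"
    show "?X N N" using that by blast
    fix N N'
    assume "?X N N'"
    then obtain M where N': "N' = N" and "infred0 M N" by blast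
    then obtain K where "lstep infred0 K N" by (auto elim: infred0.cases)
    then have "lstep (\<lambda>N N'. ?X N N' \<or> infred0 N N') N N" by (rule lstep_refl_right) blast
    then show "\<exists>K. step0\<^sup>*\<^sup>* N K \<and> lstep (\<lambda>N N'. ?X N N' \<or> infred0 N N') K N'"
      unfolding N' by blast
  qed
  from assms obtain K where "lstep infred0 K N" by (auto elim: infred0.cases)
  then show ?thesis using refl by (rule lstep_refl_right)
qed

lemma well_typed_infred0_refl:
  assumes "well_typed M" shows "infred0 M M"
proof (rule infred0_coinduct[of "\<lambda>M M'. M' = M \<and> well_typed M"])
  let ?X = "\<lambda>M M'. M' = M \<and> well_typed M"
  show "?X M M" using assms by blast
  fix M M'
  assume "?X M M'"
  then obtain \<Gamma> where M': "M' = M" and "typ_step typed \<Gamma> M"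
    using typed_iff by (auto simp: well_typed_def)
  from \<open>typ_step typed \<Gamma> M\<close> have "lstep (\<lambda>M M'. ?X M M' \<or> infred0 M M') M M"
  proof (induction rule: typ_step.induct)
    case (tmc \<Gamma> M)
    then show ?case by (intro lstep.intros) (auto simp: well_typed_def)
  qed (auto intro: lstep.intros)
  then show "\<exists>K. step0\<^sup>*\<^sup>* M K \<and> lstep (\<lambda>M M'. ?X M M' \<or> infred0 M M') K M'"
    unfolding M' by blast
qed

lemma step0_lstep_refl: "step0 M N \<Longrightarrow> lstep infred0 M M \<Longrightarrow> lstep infred0 N N"
proof (induction rule: step0.induct)
  case (step0_beta M N)
  from step0_beta.hyps step0_beta.prems show ?case
    by cases (auto elim!: lstep_leftE intro!: lstep_inst intro: lstep_imp_infred0 infred0_lstep_refl)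
qed (auto elim!: lstep_leftE intro: lstep.intros)

text \<open>A step occurs either at the surface or inside one coinductive box. In the second case it
  is absorbed by the limit layer, the other boxes being related reflexively.\<close>

lemma step_imp_step0_or_lstep:
  "step M N \<Longrightarrow> lstep infred0 M M \<Longrightarrow> step0 M N \<or> lstep infred0 M N"
proof (induction rule: step.induct)
  case (8 M M')
  from "8.prems" have M: "lstep infred0 M M" by (auto elim: lstep_CBoxE intro: infred0_lstep_refl)
  from "8.IH"[OF M] have "infred0 M M'"
  proof
    assume "step0 M M'"
    then show ?thesis using step0_lstep_refl M by (blast intro: infred0.intros)
  qed (rule lstep_imp_infred0)
  then show ?case by (blast intro: lstep.intros)
qed (auto elim!: lstep_leftE intro: step0.intros lstep.intros)

lemma step_imp_infred0:
  assumes "step M N" and "lstep infred0 M M" shows "infred0 M N"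
  using step_imp_step0_or_lstep[OF assms] step0_lstep_refl assms(2)
  by (blast intro: infred0.intros)

lemma infred0_steps:
  assumes "step\<^sup>*\<^sup>* N L" and "infred0 M N" and "well_typed M"
  shows "infred0 M L"
  using assms(1,2)
proof (induction rule: rtranclp_induct)
  case (step P Q)
  then show ?case
    using infred0_trans[OF _ _ assms(3)] step_imp_infred0 infred0_lstep_refl by blast
qed

lemma infred_imp_infred0:
  assumes "infred M N" and "well_typed M" shows "infred0 M N"
proof (rule infred0_coinduct)
  \<comment> \<open>The accumulated \<open>infred0\<close> absorbs the arbitrary finite reduction
    opening each layer of \<open>infred\<close>; inside the boxes a composition of the same form
    remains.\<close>
  let ?X = "\<lambda>M L. \<exists>N. well_typed M \<and> infred0 M N \<and> infred N L"
  show "?X M N" using assms well_typed_infred0_refl by blast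
  fix M L
  assume "?X M L"
  then obtain N K where M: "well_typed M" and "infred0 M N" "step\<^sup>*\<^sup>* N K" and K: "lstep infred K L"
    by (auto elim: infred.cases)
  then have "infred0 M K" using infred0_steps by blast
  then obtain A where A: "step0\<^sup>*\<^sup>* M A" "lstep infred0 A K" by (auto elim: infred0.cases)
  have "well_typed A" using M A(1) by (rule well_typed_step0s)
  with A(2) K have "lstep (\<lambda>M L. ?X M L \<or> infred0 M L) A L" by (rule lstep_trans) blast
  with A(1) show "\<exists>K. step0\<^sup>*\<^sup>* M K \<and> lstep (\<lambda>M L. ?X M L \<or> infred0 M L) K L" by blast
qed

lemma infred0_imp_infred:
  assumes "infred0 M N" shows "infred M N"
  using assms
proof (rule infred.coinduct)
  fix M N
  assume "infred0 M N"
  then obtain K where K: "step0\<^sup>*\<^sup>* M K" "lstep infred0 K N" by (auto elim: infred0.cases)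
  have "step\<^sup>*\<^sup>* M K" using rtranclp_cong1[of step0 step "\<lambda>M. M", OF step0_imp_step K(1)] .
  moreover have "lstep (\<lambda>M N. infred0 M N \<or> infred M N) K N" using K(2) by (rule lstep_monoD) blast
  ultimately show "\<exists>M' N' L. M = M' \<and> N = L \<and> step\<^sup>*\<^sup>* M' N' \<and> lstep (\<lambda>M N. infred0 M N \<or> infred M N) N' L"
    by blast
qed

text \<open>Below a coinductive box the environment has no PI, so the invariant demands this. It is
  the case in which surface reduction preserves the environment exactly and corecursion can go
  on.\<close>

lemma typ_step_lstep:
  "typ_step typed \<Gamma> M \<Longrightarrow> lstep infred0 M N \<Longrightarrow>
    typ_step (\<lambda>\<Gamma> N. \<exists>M. (\<forall>i. \<Gamma> i \<noteq> Some PI) \<and> typed \<Gamma> M \<and> infred0 M N) \<Gamma> N"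
proof (induction arbitrary: N rule: typ_step.induct)
  case (tmc \<Gamma> M)
  from tmc.prems obtain N' where N': "N = CBox N'" and "infred0 M N'" by (rule lstep_CBoxE)
  moreover have "\<forall>i. mc_env \<Gamma> i \<noteq> Some PI" by (simp add: mc_env_eq_Some_iff)
  ultimately show ?case using tmc.hyps by (auto intro!: typ_step.tmc)
qed (erule lstep_leftE; blast intro: typ_step.intros)+

lemma typed_infred0_no_PI:
  assumes "typed \<Gamma> M" and "infred0 M N" and "\<forall>i. \<Gamma> i \<noteq> Some PI"
  shows "typed \<Gamma> N"
proof (rule typed_coinduct)
  let ?X = "\<lambda>\<Gamma> N. \<exists>M. (\<forall>i. \<Gamma> i \<noteq> Some PI) \<and> typed \<Gamma> M \<and> infred0 M N"
  show "?X \<Gamma> N" using assms by blast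
  fix \<Gamma> N
  assume "?X \<Gamma> N"
  then obtain M K where noPI: "\<forall>i. \<Gamma> i \<noteq> Some PI" and M: "typed \<Gamma> M"
    and K: "step0\<^sup>*\<^sup>* M K" "lstep infred0 K N"
    by (auto elim: infred0.cases)
  from typed_step0s[OF K(1) M] noPI have "typed \<Gamma> K" using demotes_eq by blast
  then have "typ_step typed \<Gamma> K" by (rule typed_iff[THEN iffD1])
  then show "typ_step ?X \<Gamma> N" using K(2) by (rule typ_step_lstep)
qed

text \<open>Demotion can occur only in the surface steps of the outermost layer; the limit layer is
  then typed in the demoted environment, with its boxes covered by
  \<open>typed_infred0_no_PI\<close>.\<close>

lemma typed_infred0:
  assumes "typed \<Gamma> M" and "infred0 M N"
  shows "\<exists>\<Gamma>'. demotes \<Gamma> \<Gamma>' \<and> typed \<Gamma>' N"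
proof -
  from assms(2) obtain K where K: "step0\<^sup>*\<^sup>* M K" "lstep infred0 K N" by (auto elim: infred0.cases)
  from typed_step0s[OF K(1) assms(1)] obtain \<Gamma>' where "demotes \<Gamma> \<Gamma>'" "typed \<Gamma>' K" by blast
  moreover have "typ_step typed \<Gamma>' N"
    using typ_step_lstep[OF typed_iff[THEN iffD1, OF \<open>typed \<Gamma>' K\<close>] K(2)]
    by (rule typ_step_mono[rule_format, rotated]) (blast intro: typed_infred0_no_PI)
  ultimately show ?thesis using typed.intros by blast
qed

section \<open>Confluence\<close>

text \<open>The common ancestor is part of the invariant because it carries the typability on which
  surface confluence and commutation rely.\<close>

definition coreducts :: "trm \<Rightarrow> trm \<Rightarrow> bool" where
  "coreducts N L \<longleftrightarrow> (\<exists>M. well_typed M \<and> infred0 M N \<and> infred0 M L)"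

lemma lstep_coreducts:
  "lstep infred0 M N \<Longrightarrow> lstep infred0 M L \<Longrightarrow> well_typed M \<Longrightarrow> lstep coreducts N L"
proof (induction arbitrary: L rule: lstep.induct)
  case (7 M N)
  from "7.prems"(1) obtain L' where "L = CBox L'" "infred0 M L'" by (rule lstep_CBoxE)
  with 7 show ?case unfolding coreducts_def by (blast intro: lstep.intros dest: well_typed_sub)
next
  case (2 M N L' P)
  from "2.prems"(1) show ?case
    by (rule lstep_AppE) (use "2.IH" "2.prems" in \<open>blast intro: lstep.intros dest: well_typed_sub\<close>)
qed (erule lstep_leftE; blast intro: lstep.intros dest: well_typed_sub)+

text \<open>With \<open>M ->* A ~> N\<close> and \<open>M ->* B ~> L\<close>, surface confluence
  joins \<open>A\<close> and \<open>B\<close> in some \<open>Q\<close>. Projecting the two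
  reductions to \<open>Q\<close> along the limit layers gives \<open>N'\<close> and
  \<open>L'\<close>, both limits of \<open>Q\<close>; paired boxes thus descend from the same box of
  \<open>Q\<close>.\<close>

lemma coreducts_align:
  assumes "coreducts N L"
  shows "\<exists>N' L'. step0\<^sup>*\<^sup>* N N' \<and> step0\<^sup>*\<^sup>* L L' \<and> lstep coreducts N' L'"
proof -
  from assms obtain M A B where M: "well_typed M" and A: "step0\<^sup>*\<^sup>* M A" "lstep infred0 A N"
    and B: "step0\<^sup>*\<^sup>* M B" "lstep infred0 B L"
    by (auto simp: coreducts_def elim!: infred0.cases)
  from step0_confluent[OF M A(1) B(1)] obtain Q where Q: "step0\<^sup>*\<^sup>* A Q" "step0\<^sup>*\<^sup>* B Q" by blast
  have wt: "well_typed A" "well_typed B" using M A(1) B(1) by (auto intro: well_typed_step0s)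
  from lstep_step0s[OF Q(1) wt(1) A(2)] obtain N' where N': "step0\<^sup>*\<^sup>* N N'" "lstep infred0 Q N'" by blast
  from lstep_step0s[OF Q(2) wt(2) B(2)] obtain L' where L': "step0\<^sup>*\<^sup>* L L'" "lstep infred0 Q L'" by blast
  have "well_typed Q" using wt(1) Q(1) by (rule well_typed_step0s)
  with N'(2) L'(2) have "lstep coreducts N' L'" by (rule lstep_coreducts)
  with N'(1) L'(1) show ?thesis by blast
qed

text \<open>Corecursion needs a function, while \<open>coreducts_align\<close> only asserts
  existence; hence the choice operator.\<close>

definition align :: "trm \<Rightarrow> trm \<Rightarrow> trm \<times> trm" where
  "align N L = (SOME (N', L'). step0\<^sup>*\<^sup>* N N' \<and> step0\<^sup>*\<^sup>* L L' \<and> lstep coreducts N' L')"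

lemma align:
  assumes "coreducts N L"
  shows "step0\<^sup>*\<^sup>* N (fst (align N L))" and "step0\<^sup>*\<^sup>* L (snd (align N L))"
    and "lstep coreducts (fst (align N L)) (snd (align N L))"
proof -
  have "case align N L of (N', L') \<Rightarrow> step0\<^sup>*\<^sup>* N N' \<and> step0\<^sup>*\<^sup>* L L' \<and> lstep coreducts N' L'"
    unfolding align_def by (rule someI_ex) (use coreducts_align[OF assms] in auto)
  then show "step0\<^sup>*\<^sup>* N (fst (align N L))" "step0\<^sup>*\<^sup>* L (snd (align N L))"
    "lstep coreducts (fst (align N L)) (snd (align N L))"
    by (auto simp: case_prod_beta)
qed

text \<open>Only used for two terms of the same surface shape; otherwise the selectors on the second
  argument return junk.\<close>

primcorec merge :: "trm \<Rightarrow> trm \<Rightarrow> trm" where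
  "merge N L = (case N of
      Var i \<Rightarrow> Var i
    | App a b \<Rightarrow> App (merge a (un_App1 L)) (merge b (un_App2 L))
    | Lam a \<Rightarrow> Lam (merge a (un_Lam L))
    | LamI a \<Rightarrow> LamI (merge a (un_LamI L))
    | LamC a \<Rightarrow> LamC (merge a (un_LamC L))
    | IBox a \<Rightarrow> IBox (merge a (un_IBox L))
    | CBox a \<Rightarrow> CBox (merge (fst (align a (un_CBox L))) (snd (align a (un_CBox L)))))"

lemma merge_simps:
  "merge (Var i) (Var i) = Var i"
  "merge (App a b) (App c d) = App (merge a c) (merge b d)"
  "merge (Lam a) (Lam c) = Lam (merge a c)"
  "merge (LamI a) (LamI c) = LamI (merge a c)"
  "merge (LamC a) (LamC c) = LamC (merge a c)"
  "merge (IBox a) (IBox c) = IBox (merge a c)"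
  "merge (CBox a) (CBox c) = CBox (merge (fst (align a c)) (snd (align a c)))"
  by (subst merge.code, simp)+

text \<open>The content that \<open>merge\<close> places in a coinductive box:
  \<open>merge (CBox a) (CBox c)\<close> is \<open>CBox (join a c)\<close>. This makes the
  coinduction for \<open>infred0_join\<close> close.\<close>

definition join :: "trm \<Rightarrow> trm \<Rightarrow> trm" where
  "join N L = merge (fst (align N L)) (snd (align N L))"

lemma lstep_merge:
  assumes "lstep coreducts N L"
  shows "lstep (\<lambda>N P. \<exists>L. coreducts N L \<and> P = join N L) N (merge N L)"
    and "lstep (\<lambda>L P. \<exists>N. coreducts N L \<and> P = join N L) L (merge N L)"
  using assms
  by (induction rule: lstep.induct) (auto simp: merge_simps join_def intro: lstep.intros)

lemma infred0_join:
  assumes "coreducts N L" shows "infred0 N (join N L)" and "infred0 L (join N L)"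
proof -
  let ?X = "\<lambda>N P. \<exists>L. coreducts N L \<and> P = join N L"
  let ?Y = "\<lambda>L P. \<exists>N. coreducts N L \<and> P = join N L"
  show "infred0 N (join N L)"
  proof (rule infred0_coinduct[of ?X])
    fix N P
    assume "?X N P"
    then obtain L where NL: "coreducts N L" and P: "P = join N L" by blast
    have "lstep (\<lambda>N P. ?X N P \<or> infred0 N P) (fst (align N L)) P"
      unfolding P using lstep_merge(1)[OF align(3)[OF NL], folded join_def] by (rule lstep_monoD) blast
    then show "\<exists>K. step0\<^sup>*\<^sup>* N K \<and> lstep (\<lambda>N P. ?X N P \<or> infred0 N P) K P"
      using align(1)[OF NL] by blast
  qed (use assms in blast)
  show "infred0 L (join N L)"
  proof (rule infred0_coinduct[of ?Y])
    fix L P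
    assume "?Y L P"
    then obtain N where NL: "coreducts N L" and P: "P = join N L" by blast
    have "lstep (\<lambda>L P. ?Y L P \<or> infred0 L P) (snd (align N L)) P"
      unfolding P using lstep_merge(2)[OF align(3)[OF NL], folded join_def] by (rule lstep_monoD) blast
    then show "\<exists>K. step0\<^sup>*\<^sup>* L K \<and> lstep (\<lambda>L P. ?Y L P \<or> infred0 L P) K P"
      using align(2)[OF NL] by blast
  qed (use assms in blast)
qed

theorem mainTheorem16:
  assumes "lterm M" and "infred M N" and "infred M L"
  shows "\<exists>P. lterm P \<and> infred N P \<and> infred L P"
proof -
  from assms(1) obtain \<Gamma> where \<Gamma>: "finite (dom \<Gamma>)" "typed \<Gamma> M"
    unfolding lterm_def by blast
  then have M: "well_typed M" unfolding well_typed_def by blast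
  have N: "infred0 M N" and L: "infred0 M L"
    using assms(2,3) M by (simp_all add: infred_imp_infred0)
  then have NL: "coreducts N L" unfolding coreducts_def using M by blast
  \<comment> \<open>The join is seen as a reduct of \<open>M\<close> itself, so that subject
    reduction starts from the given environment with finite domain.\<close>
  have "infred0 M (join N L)" using N infred0_join(1)[OF NL] M by (rule infred0_trans)
  from typed_infred0[OF \<Gamma>(2) this] obtain \<Gamma>' where "demotes \<Gamma> \<Gamma>'" "typed \<Gamma>' (join N L)" by blast
  then have "lterm (join N L)"
    unfolding lterm_def using \<Gamma>(1) demotes_dom by metis
  moreover have "infred N (join N L)" "infred L (join N L)"
    using infred0_join[OF NL] by (simp_all add: infred0_imp_infred)
  ultimately show ?thesis by blast
qed

end
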